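(* Let $d\in\mathbb N$. There is a unique $\mathbb K$-algebra isomorphism $$\mathbf U^{\mathrm{id}}(2,d)\xrightarrow{\ \sim\ }\mathbf U(2,d)$$ which sends $\boldsymbol e\mapsto e$, $\boldsymbol f\mapsto f$, $\boldsymbol\ell\mapsto\ell$, and $\boldsymbol\varepsilon_r\mapsto\varepsilon_r$ for $0\le r\le d$.
   Context: $v$ is an indeterminate, $\mathbb K=\mathbb C(v)$, $\mathbb N=\{0,1,2,\dots\}$, $[m]=\frac{v^m-v^{-m}}{v-v^{-1}}$ for $m\in\mathbb Z$, and $\alpha_r=v^{2r-d}$ for $0\le r\le d$. $\mathbf U^{\mathrm{mir}}_v(2)$ is the unital associative $\mathbb K$-algebra generated by $e,f,k,k^{-1},\ell$ subject to: $kk^{-1}=k^{-1}k=1$; $kek^{-1}=v^2e$, $kfk^{-1}=v^{-2}f$; $ef-fe=(k-k^{-1})/(v-v^{-1})$; $\ell^2=\ell$, $k\ell=\ell k$, $\ell e\ell=\ell e$, $\ell f\ell=f\ell$; $[2]e\ell e=v^{-1}e^2\ell+v\ell e^2$; $[2]f\ell f=v^{-1}\ell f^2+vf^2\ell$. $\mathbf U(2,d)$ is the quotient of $\mathbf U^{\mathrm{mir}}_v(2)$ by the two-sided ideal generated by $P_d(k)=\prod_{r=0}^{d}(k-\alpha_r)$ and $(\ell-1)Q_d(k)$, where $Q_d(k)=\prod_{r=1}^{d}(k-\alpha_r)$ (so $Q_0=1$); images of generators are denoted by the same letters. In $\mathbf U(2,d)$ put $\varepsilon_r=L_r(k)$,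 where $L_r(X)=\prod_{0\le s\le d,\,s\ne r}\frac{X-\alpha_s}{\alpha_r-\alpha_s}\in\mathbb K[X]$. $\mathbf U^{\mathrm{id}}(2,d)$ is the unital $\mathbb K$-algebra generated by $\boldsymbol e,\boldsymbol f,\boldsymbol\ell,\boldsymbol\varepsilon_0,\dots,\boldsymbol\varepsilon_d$, with the convention $\boldsymbol\varepsilon_j=0$ for $j\notin\{0,\dots,d\}$, subject to the relations (for all $0\le r,s\le d$): $\boldsymbol\varepsilon_r\boldsymbol\varepsilon_s=\delta_{r,s}\boldsymbol\varepsilon_r$; $\sum_{r=0}^d\boldsymbol\varepsilon_r=1$; $\boldsymbol e\boldsymbol\varepsilon_r=\boldsymbol\varepsilon_{r+1}\boldsymbol e$; $\boldsymbol f\boldsymbol\varepsilon_r=\boldsymbol\varepsilon_{r-1}\boldsymbol f$; $\boldsymbol e\boldsymbol f-\boldsymbol f\boldsymbol e=\sum_{r=0}^d[2r-d]\boldsymbol\varepsilon_r$; $\boldsymbol\ell^2=\boldsymbol\ell$; $\boldsymbol\ell\boldsymbol\varepsilon_r=\boldsymbol\varepsilon_r\boldsymbol\ell$; $\boldsymbol\ell\boldsymbol\varepsilon_0=\boldsymbol\varepsilon_0$; $\boldsymbol\ell\boldsymbol e\boldsymbol\ell=\boldsymbol\ell\boldsymbol e$; $\boldsymbol\ell\boldsymbol f\boldsymbol\ell=\boldsymbol f\boldsymbol\ell$; $[2]\boldsymbol e\boldsymbol\ell\boldsymbol e=v^{-1}\boldsymbol e^2\boldsymbol\ell+v\boldsymbol\ell\boldsymbol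 e^2$; $[2]\boldsymbol f\boldsymbol\ell\boldsymbol f=v^{-1}\boldsymbol\ell\boldsymbol f^2+v\boldsymbol f^2\boldsymbol\ell$. *)

theory Defs
  imports
    "HOL-Algebra.QuotRing"
    "HOL-Algebra.Module"
    "HOL-Library.Poly_Mapping"
    "HOL-Library.FuncSet"
    "HOL-Computational_Algebra.Polynomial"
    "HOL-Computational_Algebra.Fraction_Field"
begin

type_synonym ratfun = "complex poly fract"

definition qv :: ratfun where
  "qv = Fraction_Field.Fract [:0, 1:] 1"

definition qint :: "int \<Rightarrow> ratfun" where
  "qint m = (qv powi m - qv powi (- m)) / (qv - inverse qv)"

definition qalpha :: "nat \<Rightarrow> nat \<Rightarrow> ratfun" where
  "qalpha d r = qv powi (2 * int r - int d)"

text \<open>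
  The free monoid on a type of letters, written additively: the convolution product of
  \<^theory>\<open>HOL-Library.Poly_Mapping\<close> is based on \<^class>\<open>monoid_add\<close>.
  The sum of two words is their concatenation, which is not commutative.
\<close>

datatype 'x fmon = Mon (letters: "'x list")

instantiation fmon :: (type) monoid_add
begin

definition zero_fmon :: "'a fmon" where
  "zero_fmon = Mon []"

definition plus_fmon :: "'a fmon \<Rightarrow> 'a fmon \<Rightarrow> 'a fmon" where
  "plus_fmon u w = Mon (letters u @ letters w)"

instance
  by standard (simp_all add: zero_fmon_def plus_fmon_def)

end

type_synonym ('x, 'k) fpoly = "'x fmon \<Rightarrow>\<^sub>0 'k"

definition gen :: "'x \<Rightarrow> ('x, 'k::comm_ring_1) fpoly" where
  "gen x = Poly_Mapping.single (Mon [x]) 1"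

definition scal :: "'k \<Rightarrow> ('x, 'k::comm_ring_1) fpoly" where
  "scal c = Poly_Mapping.single 0 c"

text \<open>
  Algebras over a type \<open>'k\<close> of scalars are represented by \<^type>\<open>module\<close> records; they need not
  be commutative.
\<close>

definition free_alg :: "'x set \<Rightarrow> ('k::comm_ring_1, ('x, 'k) fpoly) module" where
  "free_alg X =
    \<lparr>carrier = {p. \<forall>w \<in> Poly_Mapping.keys p. set (letters w) \<subseteq> X},
     monoid.mult = (*), one = 1, zero = 0, add = (+), module.smult = (\<lambda>c p. scal c * p)\<rparr>"

definition quot_alg :: "('k, 'a) module \<Rightarrow> 'a set \<Rightarrow> ('k, 'a set) module" where
  "quot_alg A I =
    \<lparr>carrier = carrier (A Quot I), monoid.mult = monoid.mult (A Quot I), one = one (A Quot I),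
     zero = zero (A Quot I), add = add (A Quot I),
     module.smult = (\<lambda>c S. \<Union>x\<in>S. I +>\<^bsub>A\<^esub> (c \<odot>\<^bsub>A\<^esub> x))\<rparr>"

definition alg_iso :: "('k, 'a) module \<Rightarrow> ('k, 'b) module \<Rightarrow> ('a \<Rightarrow> 'b) set" where
  "alg_iso A B =
    {h \<in> ring_iso A B. \<forall>c. \<forall>x \<in> carrier A. h (c \<odot>\<^bsub>A\<^esub> x) = c \<odot>\<^bsub>B\<^esub> h x}"

definition alg_eval :: "('k::comm_ring_1, 'a) module \<Rightarrow> 'k poly \<Rightarrow> 'a \<Rightarrow> 'a" where
  "alg_eval A p a =
    finsum A (\<lambda>i. coeff p i \<odot>\<^bsub>A\<^esub> (a [^]\<^bsub>A\<^esub> i)) {..degree p}"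

datatype mir_gen = Mir_e | Mir_f | Mir_k | Mir_kinv | Mir_l

text \<open>A relation \<open>a = b\<close> is encoded by the element \<open>a - b\<close> of the free algebra.\<close>

definition mir_rels :: "(mir_gen, ratfun) fpoly set" where
  "mir_rels =
    (let e = gen Mir_e; f = gen Mir_f; k = gen Mir_k; k' = gen Mir_kinv; l = gen Mir_l in
     {k * k' - 1,
      k' * k - 1,
      k * e * k' - scal (qv ^ 2) * e,
      k * f * k' - scal (qv powi (-2)) * f,
      (e * f - f * e) - scal (1 / (qv - inverse qv)) * (k - k'),
      l ^ 2 - l,
      k * l - l * k,
      l * e * l - l * e,
      l * f * l - f * l,
      scal (qint 2) * (e * l * e)
        - (scal (inverse qv) * (e ^ 2 * l) + scal qv * (l * e ^ 2)),
      scal (qint 2) * (f * l * f)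
        - (scal (inverse qv) * (l * f ^ 2) + scal qv * (f ^ 2 * l))})"

definition mir_ideal :: "(mir_gen, ratfun) fpoly set" where
  "mir_ideal = Idl\<^bsub>free_alg UNIV\<^esub> mir_rels"

definition U_mir :: "(ratfun, (mir_gen, ratfun) fpoly set) module" where
  "U_mir = quot_alg (free_alg UNIV) mir_ideal"

definition mir_elt :: "mir_gen \<Rightarrow> (mir_gen, ratfun) fpoly set" where
  "mir_elt x = mir_ideal +>\<^bsub>free_alg UNIV\<^esub> gen x"

definition P_poly :: "nat \<Rightarrow> ratfun poly" where
  "P_poly d = (\<Prod>r = 0..d. [:- qalpha d r, 1:])"

definition Q_poly :: "nat \<Rightarrow> ratfun poly" where
  "Q_poly d = (\<Prod>r = 1..d. [:- qalpha d r, 1:])"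

definition L_poly :: "nat \<Rightarrow> nat \<Rightarrow> ratfun poly" where
  "L_poly d r =
    (\<Prod>s \<in> {0..d} - {r}. Polynomial.smult (1 / (qalpha d r - qalpha d s)) [:- qalpha d s, 1:])"

text \<open>The ideal is taken in \<open>U_mir\<close>, so the elements of \<open>U2 d\<close> are cosets of cosets.\<close>

definition U2_ideal :: "nat \<Rightarrow> (mir_gen, ratfun) fpoly set set" where
  "U2_ideal d = Idl\<^bsub>U_mir\<^esub>
    {alg_eval U_mir (P_poly d) (mir_elt Mir_k),
     (mir_elt Mir_l \<ominus>\<^bsub>U_mir\<^esub> \<one>\<^bsub>U_mir\<^esub>) \<otimes>\<^bsub>U_mir\<^esub> alg_eval U_mir (Q_poly d) (mir_elt Mir_k)}"

definition U2 :: "nat \<Rightarrow> (ratfun, (mir_gen, ratfun) fpoly set set) module" where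
  "U2 d = quot_alg U_mir (U2_ideal d)"

definition U2_elt :: "nat \<Rightarrow> mir_gen \<Rightarrow> (mir_gen, ratfun) fpoly set set" where
  "U2_elt d x = U2_ideal d +>\<^bsub>U_mir\<^esub> mir_elt x"

definition U2_eps :: "nat \<Rightarrow> nat \<Rightarrow> (mir_gen, ratfun) fpoly set set" where
  "U2_eps d r = alg_eval (U2 d) (L_poly d r) (U2_elt d Mir_k)"

datatype id_gen = Id_e | Id_f | Id_l | Id_eps nat

definition id_gens :: "nat \<Rightarrow> id_gen set" where
  "id_gens d = {Id_e, Id_f, Id_l} \<union> Id_eps ` {0..d}"

text \<open>The index is an integer so that the generators with index \<open>-1\<close> and \<open>d + 1\<close> are \<open>0\<close>.\<close>

definition eps_gen :: "nat \<Rightarrow> int \<Rightarrow> (id_gen, ratfun) fpoly" where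
  "eps_gen d j = (if 0 \<le> j \<and> j \<le> int d then gen (Id_eps (nat j)) else 0)"

definition id_rels :: "nat \<Rightarrow> (id_gen, ratfun) fpoly set" where
  "id_rels d =
    (let e = gen Id_e; f = gen Id_f; l = gen Id_l; eps = eps_gen d in
     {eps (int r) * eps (int s) - (if r = s then eps (int r) else 0) | r s. r \<le> d \<and> s \<le> d} \<union>
     {(\<Sum>r = 0..d. eps (int r)) - 1} \<union>
     {e * eps (int r) - eps (int r + 1) * e | r. r \<le> d} \<union>
     {f * eps (int r) - eps (int r - 1) * f | r. r \<le> d} \<union>
     {(e * f - f * e) - (\<Sum>r = 0..d. scal (qint (2 * int r - int d)) * eps (int r))} \<union>
     {l ^ 2 - l} \<union>
     {l * eps (int r) - eps (int r) * l | r. r \<le> d} \<union>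
     {l * eps 0 - eps 0} \<union>
     {l * e * l - l * e,
      l * f * l - f * l,
      scal (qint 2) * (e * l * e)
        - (scal (inverse qv) * (e ^ 2 * l) + scal qv * (l * e ^ 2)),
      scal (qint 2) * (f * l * f)
        - (scal (inverse qv) * (l * f ^ 2) + scal qv * (f ^ 2 * l))})"

definition id_ideal :: "nat \<Rightarrow> (id_gen, ratfun) fpoly set" where
  "id_ideal d = Idl\<^bsub>free_alg (id_gens d)\<^esub> (id_rels d)"

definition U_id :: "nat \<Rightarrow> (ratfun, (id_gen, ratfun) fpoly set) module" where
  "U_id d = quot_alg (free_alg (id_gens d)) (id_ideal d)"

definition id_elt :: "nat \<Rightarrow> id_gen \<Rightarrow> (id_gen, ratfun) fpoly set" where
  "id_elt d x = id_ideal d +>\<^bsub>free_alg (id_gens d)\<^esub> gen x"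

end

theory Submission
  imports Defs
begin

text \<open>
The idempotent presentation replaces the generator \<open>k\<close> of \<open>U2 d\<close> by its spectral idempotents. In
\<open>U2 d\<close> the element \<open>k\<close> is a root of \<open>P\<close>, a product of linear factors with the pairwise distinct
roots \<open>\<alpha>\<^sub>r = v\<^sup>2\<^sup>r\<^sup>-\<^sup>d\<close> (the weights). So the Lagrange polynomials at \<open>k\<close> are orthogonal idempotents
\<open>\<epsilon>\<^sub>r\<close> that add up to \<open>1\<close>, and \<open>k = \<Sum>r. \<alpha>\<^sub>r \<epsilon>\<^sub>r\<close>. Conversely, for any complete family of orthogonal
idempotents this sum is an invertible root of \<open>P\<close> whose Lagrange idempotents are the given ones.
Thus the choice of \<open>k\<close> and the choice of the idempotents amount to the same thing, and the other
relations match under this dictionary: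

\<^item> \<open>k e k\<^sup>-\<^sup>1 = v\<^sup>2 e\<close> says that \<open>e\<close> maps the weight \<open>\<alpha>\<^sub>r\<close> to \<open>v\<^sup>2 \<alpha>\<^sub>r = \<alpha>\<^sub>r\<^sub>+\<^sub>1\<close>, that is,
  \<open>e \<epsilon>\<^sub>r = \<epsilon>\<^sub>r\<^sub>+\<^sub>1 e\<close>, and similarly for \<open>f\<close>;
\<^item> \<open>(k - k\<^sup>-\<^sup>1) / (v - v\<^sup>-\<^sup>1)\<close> acts on the \<open>r\<close>-th block as the quantum integer of \<open>2r - d\<close>;
\<^item> \<open>Q\<close> vanishes at all weights but \<open>\<alpha>\<^sub>0\<close>, so \<open>(l - 1) Q(k) = 0\<close> says that \<open>l \<epsilon>\<^sub>0 = \<epsilon>\<^sub>0\<close>.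

This dictionary is established in an arbitrary algebra, by \<open>mir_imp_id\<close> and \<open>id_imp_mir\<close>. The
universal properties of the two presented algebras (\<open>U_id_universal\<close>, \<open>U2_universal\<close>) turn it into
homomorphisms in both directions, which are inverse to each other because they are so on
generators. Uniqueness of the isomorphism holds because the generators generate.
\<close>

section \<open>Algebras and their homomorphisms\<close>

text \<open>
Algebras over a commutative ring of scalars, not necessarily commutative. The last two axioms
say that scalars commute with all elements; as simplification rules, together with
\<open>smult_smult\<close>, they collect all scalar factors of a product in front of it.
\<close>

locale kalgebra = ring A for A :: "('k::comm_ring_1, 'a) module" (structure) +
  assumes smult_closed [simp, intro]: "x \<in> carrier A \<Longrightarrow> c \<odot> x \<in> carrier A"
    and smult_l_distr: "x \<in> carrier A \<Longrightarrow> (b + c) \<odot> x = b \<odot> x \<oplus> c \<odot> x"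
    and smult_r_distr: "x \<in> carrier A \<Longrightarrow> y \<in> carrier A \<Longrightarrow> c \<odot> (x \<oplus> y) = c \<odot> x \<oplus> c \<odot> y"
    and smult_smult [simp]: "x \<in> carrier A \<Longrightarrow> b \<odot> (c \<odot> x) = (b * c) \<odot> x"
    and smult_one [simp]: "x \<in> carrier A \<Longrightarrow> 1 \<odot> x = x"
    and smult_mult_left [simp]:
      "x \<in> carrier A \<Longrightarrow> y \<in> carrier A \<Longrightarrow> (c \<odot> x) \<otimes> y = c \<odot> (x \<otimes> y)"
    and smult_mult_right [simp]:
      "x \<in> carrier A \<Longrightarrow> y \<in> carrier A \<Longrightarrow> x \<otimes> (c \<odot> y) = c \<odot> (x \<otimes> y)"
begin

lemma minus_eq_zero_iff [simp]:
  assumes "x \<in> carrier A" "y \<in> carrier A"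
  shows "x \<ominus> y = \<zero> \<longleftrightarrow> x = y"
  using assms minus_equality[of x "\<ominus> y"] by (auto simp: minus_eq r_neg)

lemma smult_zero_left [simp]: "x \<in> carrier A \<Longrightarrow> 0 \<odot> x = \<zero>"
  using smult_l_distr[of x 0 0] by (simp add: add.r_cancel_one')

lemma smult_zero_right [simp]: "c \<odot> \<zero> = \<zero>"
  using smult_r_distr[of \<zero> \<zero> c] by (simp add: add.r_cancel_one')

lemma smult_uminus: "x \<in> carrier A \<Longrightarrow> (- c) \<odot> x = \<ominus> (c \<odot> x)"
  using smult_l_distr[of x "- c" c] by (simp add: minus_equality)

lemma smult_diff: "x \<in> carrier A \<Longrightarrow> (b - c) \<odot> x = b \<odot> x \<ominus> c \<odot> x"
  using smult_l_distr[of x b "- c"] by (simp add: smult_uminus minus_eq)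

lemma smult_minus_right: "x \<in> carrier A \<Longrightarrow> c \<odot> (\<ominus> x) = \<ominus> (c \<odot> x)"
  by (metis a_inv_closed minus_equality r_neg smult_closed smult_r_distr smult_zero_right add.m_comm)

lemma smult_minus_distr:
  "x \<in> carrier A \<Longrightarrow> y \<in> carrier A \<Longrightarrow> c \<odot> (x \<ominus> y) = c \<odot> x \<ominus> c \<odot> y"
  by (simp add: minus_eq smult_r_distr smult_minus_right)

end

definition alg_hom :: "('k, 'a) module \<Rightarrow> ('k, 'b) module \<Rightarrow> ('a \<Rightarrow> 'b) set" where
  "alg_hom A B =
    {h \<in> ring_hom A B. \<forall>c. \<forall>x \<in> carrier A. h (c \<odot>\<^bsub>A\<^esub> x) = c \<odot>\<^bsub>B\<^esub> h x}"

lemma alg_hom_compose: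
  assumes "g \<in> alg_hom A B" "h \<in> alg_hom B C"
  shows "h \<circ> g \<in> alg_hom A C"
  using assms by (auto simp: alg_hom_def ring_hom_trans ring_hom_closed)

locale kalgebra_hom = A: kalgebra A + B: kalgebra B
  for A :: "('k::comm_ring_1, 'a) module" and B :: "('k, 'b) module" +
  fixes h
  assumes hom: "h \<in> alg_hom A B"
begin

lemma ring_hom: "h \<in> ring_hom A B" using hom by (simp add: alg_hom_def)

lemma hom_closed [simp, intro]: "x \<in> carrier A \<Longrightarrow> h x \<in> carrier B"
  by (rule ring_hom_closed[OF ring_hom])

lemma hom_mult [simp]:
  "x \<in> carrier A \<Longrightarrow> y \<in> carrier A \<Longrightarrow> h (x \<otimes>\<^bsub>A\<^esub> y) = h x \<otimes>\<^bsub>B\<^esub> h y"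
  by (rule ring_hom_mult[OF ring_hom])

lemma hom_add [simp]:
  "x \<in> carrier A \<Longrightarrow> y \<in> carrier A \<Longrightarrow> h (x \<oplus>\<^bsub>A\<^esub> y) = h x \<oplus>\<^bsub>B\<^esub> h y"
  by (rule ring_hom_add[OF ring_hom])

lemma hom_one [simp]: "h \<one>\<^bsub>A\<^esub> = \<one>\<^bsub>B\<^esub>"
  by (rule ring_hom_one[OF ring_hom])

lemma hom_zero [simp]: "h \<zero>\<^bsub>A\<^esub> = \<zero>\<^bsub>B\<^esub>"
  by (rule ring_hom_zero[OF ring_hom A.ring_axioms B.ring_axioms])

lemma hom_smult [simp]: "x \<in> carrier A \<Longrightarrow> h (c \<odot>\<^bsub>A\<^esub> x) = c \<odot>\<^bsub>B\<^esub> h x"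
  using hom by (simp add: alg_hom_def)

lemma hom_minus [simp]:
  "x \<in> carrier A \<Longrightarrow> y \<in> carrier A \<Longrightarrow> h (x \<ominus>\<^bsub>A\<^esub> y) = h x \<ominus>\<^bsub>B\<^esub> h y"
proof -
  assume xy: "x \<in> carrier A" "y \<in> carrier A"
  have "x \<ominus>\<^bsub>A\<^esub> y = x \<oplus>\<^bsub>A\<^esub> (- 1) \<odot>\<^bsub>A\<^esub> y" using xy by (simp add: A.smult_uminus A.minus_eq)
  then show ?thesis using xy by (simp add: B.smult_uminus B.minus_eq)
qed

lemma hom_finsum [simp]:
  assumes "x \<in> S \<rightarrow> carrier A"
  shows "h (finsum A x S) = finsum B (\<lambda>i. h (x i)) S"
proof (cases "finite S")
  case True
  then show ?thesis using assms
  proof (induction S rule: finite_induct)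
    case (insert i S)
    then have "(\<lambda>i. h (x i)) \<in> S \<rightarrow> carrier B" "x \<in> S \<rightarrow> carrier A" by auto
    with insert show ?case by simp
  qed simp
qed (simp add: A.finsum_infinite B.finsum_infinite)

lemma vanishes_on_genideal:
  assumes "S \<subseteq> carrier A" and "\<And>r. r \<in> S \<Longrightarrow> h r = \<zero>\<^bsub>B\<^esub>" and "x \<in> Idl\<^bsub>A\<^esub> S"
  shows "h x = \<zero>\<^bsub>B\<^esub>"
proof -
  have "ring_hom_ring A B h"
    by (rule ring_hom_ringI2[OF A.ring_axioms B.ring_axioms ring_hom])
  then have "ideal (a_kernel A B h) A" by (rule ring_hom_ring.kernel_is_ideal)
  moreover have "S \<subseteq> a_kernel A B h" using assms(1,2) unfolding a_kernel_def' by blast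
  ultimately have "Idl\<^bsub>A\<^esub> S \<subseteq> a_kernel A B h" by (rule A.genideal_minimal)
  with assms(3) show ?thesis unfolding a_kernel_def' by blast
qed

end

section \<open>Free algebras\<close>

lemma free_alg_simps:
  "monoid.mult (free_alg X) = (*)" "one (free_alg X) = 1" "zero (free_alg X) = 0"
  "add (free_alg X) = (+)" "module.smult (free_alg X) = (\<lambda>c p. scal c * p)"
  by (simp_all add: free_alg_def)

lemma carrier_free_alg:
  "p \<in> carrier (free_alg X) \<longleftrightarrow> (\<forall>w \<in> Poly_Mapping.keys p. set (letters w) \<subseteq> X)"
  by (simp add: free_alg_def)

lemma scal_add: "scal (a + b) = scal a + scal b"
  by (simp add: scal_def single_add)

lemma scal_mult: "scal (a * b) = scal a * scal b"
  by (simp add: scal_def mult_single)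

lemma scal_one [simp]: "scal 1 = 1"
  by (simp add: scal_def single_one)

lemma scal_mult_single: "scal c * Poly_Mapping.single w b = Poly_Mapping.single w (c * b)"
  by (simp add: scal_def mult_single)

lemma letters_zero [simp]: "letters 0 = []"
  by (simp add: zero_fmon_def)

lemma letters_plus [simp]: "letters (u + w) = letters u @ letters w"
  by (simp add: plus_fmon_def)

text \<open>
Induction over the support: a noncommutative polynomial is built up by adding terms one at a
time, and all its words stay in the alphabet \<open>X\<close>.
\<close>

lemma fpoly_induct [consumes 1, case_names zero add]:
  fixes p :: "('x, 'k::comm_ring_1) fpoly"
  assumes "p \<in> carrier (free_alg X)" and "P 0"
    and "\<And>w c p. set (letters w) \<subseteq> X \<Longrightarrow> p \<in> carrier (free_alg X) \<Longrightarrow> P p \<Longrightarrow>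
      P (Poly_Mapping.single w c + p)"
  shows "P p"
  using assms(1)
proof (induction p rule: update_induct)
  case const
  show ?case by (rule assms(2))
next
  case (update p w c)
  have eq: "Poly_Mapping.update w c p = Poly_Mapping.single w c + p"
    using update.hyps(1)
    by (intro poly_mapping_eqI)
      (auto simp: lookup_update lookup_add lookup_single in_keys_iff when_def)
  have "Poly_Mapping.keys (Poly_Mapping.update w c p) = insert w (Poly_Mapping.keys p)"
    using update.hyps by (auto simp: in_keys_iff lookup_update split: if_splits)
  with update show ?case by (auto simp: carrier_free_alg eq intro!: assms(3))
qed

text \<open>
A scalar is a multiple of the empty word, which commutes with all words.
\<close>

lemma scal_central: "p * scal c = scal c * p"
proof -
  have "p \<in> carrier (free_alg UNIV)" by (simp add: carrier_free_alg)
  then show ?thesis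
    by (induction p rule: fpoly_induct)
      (simp_all add: distrib_left distrib_right scal_def mult_single mult.commute)
qed

lemma gen_in_free_alg [simp]: "x \<in> X \<Longrightarrow> gen x \<in> carrier (free_alg X)"
  by (simp add: carrier_free_alg gen_def)

lemma scal_in_free_alg [simp]: "scal c \<in> carrier (free_alg X)"
  by (simp add: carrier_free_alg scal_def)

lemma free_alg_closed:
  fixes p q :: "('x, 'k::comm_ring_1) fpoly"
  assumes "p \<in> carrier (free_alg X)" "q \<in> carrier (free_alg X)"
  shows "p + q \<in> carrier (free_alg X)" "p * q \<in> carrier (free_alg X)"
    "- p \<in> carrier (free_alg X)" "p - q \<in> carrier (free_alg X)"
proof -
  have add: "p + q \<in> carrier (free_alg X)" if "q \<in> carrier (free_alg X)" for q
    using assms(1) that keys_add[of p q] by (auto simp: carrier_free_alg)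
  have neg: "- p \<in> carrier (free_alg X)" if "p \<in> carrier (free_alg X)" for p :: "('x, 'k) fpoly"
    using that by (simp add: carrier_free_alg in_keys_iff)
  show "p + q \<in> carrier (free_alg X)" by (rule add) fact
  show "p * q \<in> carrier (free_alg X)"
    using assms keys_mult[of p q] by (fastforce simp: carrier_free_alg)
  show "- p \<in> carrier (free_alg X)" by (rule neg) fact
  show "p - q \<in> carrier (free_alg X)"
    using add[OF neg[OF assms(2)]] by simp
qed

lemma zero_one_in_free_alg [simp]:
  "0 \<in> carrier (free_alg X)" "1 \<in> carrier (free_alg X)"
  using scal_in_free_alg[of 1 X] by (simp_all add: carrier_free_alg)

lemma kalgebra_free_alg:
  "kalgebra (free_alg X :: ('k::comm_ring_1, ('x, 'k) fpoly) module)"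
proof -
  let ?F = "free_alg X :: ('k, ('x, 'k) fpoly) module"
  have "ring ?F"
  proof (rule ringI)
    show "abelian_group ?F"
    proof (rule abelian_groupI)
      fix x :: "('x, 'k) fpoly" assume "x \<in> carrier ?F"
      then show "\<exists>y\<in>carrier ?F. y \<oplus>\<^bsub>?F\<^esub> x = \<zero>\<^bsub>?F\<^esub>"
        by (intro bexI[of _ "- x"]) (simp_all add: free_alg_simps free_alg_closed)
    qed (simp_all add: free_alg_simps free_alg_closed)
    show "monoid ?F"
      by (rule monoidI) (simp_all add: free_alg_simps free_alg_closed mult.assoc)
  qed (simp_all add: free_alg_simps algebra_simps)
  then show ?thesis
  proof (intro kalgebra.intro kalgebra_axioms.intro)
    fix c and p q :: "('x, 'k) fpoly"
    show "p \<otimes>\<^bsub>?F\<^esub> (c \<odot>\<^bsub>?F\<^esub> q) = c \<odot>\<^bsub>?F\<^esub> (p \<otimes>\<^bsub>?F\<^esub> q)"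
      unfolding free_alg_simps by (metis mult.assoc scal_central)
  qed (simp_all add: free_alg_simps free_alg_closed scal_add scal_mult
      distrib_left distrib_right mult.assoc)
qed

lemma minus_free_alg [simp]:
  assumes "p \<in> carrier (free_alg X)" "q \<in> carrier (free_alg X)"
  shows "p \<ominus>\<^bsub>free_alg X\<^esub> q = p - q"
proof -
  interpret kalgebra "free_alg X" by (rule kalgebra_free_alg)
  have "p - q = p \<ominus>\<^bsub>free_alg X\<^esub> q"
    using assms minus_equality[of "- q" q]
    by (simp add: a_minus_def free_alg_simps free_alg_closed)
  then show ?thesis by simp
qed

definition word_eval :: "('k::comm_ring_1, 'a) module \<Rightarrow> ('x \<Rightarrow> 'a) \<Rightarrow> 'x fmon \<Rightarrow> 'a" where
  "word_eval B g w = foldr (\<lambda>x y. g x \<otimes>\<^bsub>B\<^esub> y) (letters w) \<one>\<^bsub>B\<^esub>"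

definition free_eval :: "('k::comm_ring_1, 'a) module \<Rightarrow> ('x \<Rightarrow> 'a) \<Rightarrow> ('x, 'k) fpoly \<Rightarrow> 'a" where
  "free_eval B g p =
    finsum B (\<lambda>w. Poly_Mapping.lookup p w \<odot>\<^bsub>B\<^esub> word_eval B g w) (Poly_Mapping.keys p)"

locale kalgebra_point = kalgebra B for B :: "('k::comm_ring_1, 'a) module" (structure) +
  fixes g :: "'x \<Rightarrow> 'a"
  assumes g_closed [simp, intro]: "g x \<in> carrier B"
begin

lemma word_eval_closed [simp, intro]: "word_eval B g w \<in> carrier B"
proof -
  have "foldr (\<lambda>x y. g x \<otimes> y) xs \<one> \<in> carrier B" for xs
    by (induction xs) auto
  then show ?thesis by (simp add: word_eval_def)
qed

lemma word_eval_plus: "word_eval B g (u + w) = word_eval B g u \<otimes> word_eval B g w"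
proof -
  have cl: "foldr (\<lambda>x y. g x \<otimes> y) xs \<one> \<in> carrier B" for xs
    by (induction xs) auto
  have "foldr (\<lambda>x y. g x \<otimes> y) xs z = foldr (\<lambda>x y. g x \<otimes> y) xs \<one> \<otimes> z"
    if "z \<in> carrier B" for xs z
    using cl that by (induction xs) (auto simp: m_assoc)
  from this[OF cl] show ?thesis unfolding word_eval_def letters_plus foldr_append o_apply .
qed

lemma free_eval_superset:
  assumes "finite S" "Poly_Mapping.keys p \<subseteq> S"
  shows "free_eval B g p = finsum B (\<lambda>w. Poly_Mapping.lookup p w \<odot> word_eval B g w) S"
  unfolding free_eval_def using assms
  by (intro add.finprod_mono_neutral_cong_left) (auto simp: in_keys_iff)

lemma free_eval_closed [simp, intro]: "free_eval B g p \<in> carrier B"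
  unfolding free_eval_def by (rule finsum_closed) auto

lemma free_eval_add [simp]: "free_eval B g (p + q) = free_eval B g p \<oplus> free_eval B g q"
proof -
  define S where "S = Poly_Mapping.keys p \<union> Poly_Mapping.keys q"
  have S: "finite S" "Poly_Mapping.keys p \<subseteq> S" "Poly_Mapping.keys q \<subseteq> S"
    "Poly_Mapping.keys (p + q) \<subseteq> S"
    using keys_add[of p q] by (auto simp: S_def)
  show ?thesis
    unfolding S(2-4)[THEN free_eval_superset[OF S(1)]]
    by (subst finsum_addf[symmetric]) (auto simp: lookup_add smult_l_distr)
qed

lemma free_eval_single [simp]:
  "free_eval B g (Poly_Mapping.single w c) = c \<odot> word_eval B g w"
  by (subst free_eval_superset[of "{w}"]) auto

lemma free_eval_mult [simp]: "free_eval B g (p * q) = free_eval B g p \<otimes> free_eval B g q"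
proof -
  have z: "free_eval B g 0 = \<zero>" by (simp add: free_eval_def)
  have U: "r \<in> carrier (free_alg UNIV)" for r :: "('x, 'k) fpoly" by (simp add: carrier_free_alg)
  have *: "free_eval B g (Poly_Mapping.single u a * q) =
      free_eval B g (Poly_Mapping.single u a) \<otimes> free_eval B g q" for u a
    using U[of q]
    by (induction q rule: fpoly_induct)
      (simp_all add: z distrib_left r_distr mult_single word_eval_plus mult.commute)
  show ?thesis
    using U[of p]
    by (induction p rule: fpoly_induct) (simp_all add: z distrib_right l_distr *)
qed

lemma free_eval_gen [simp]: "free_eval B g (gen x) = g x"
  by (simp add: gen_def word_eval_def)

lemma free_eval_scal: "free_eval B g (scal c) = c \<odot> \<one>"
  by (simp add: scal_def word_eval_def)

lemma free_eval_hom: "free_eval B g \<in> alg_hom (free_alg X) B"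
  using free_eval_scal[of 1]
  by (auto simp: alg_hom_def free_alg_simps free_eval_scal intro!: ring_hom_memI)

end

text \<open>
The universal property of the free algebra. Existence is substitution of values for the letters;
uniqueness holds because every element is a linear combination of products of letters.
\<close>

lemma free_alg_hom_exists:
  assumes "kalgebra B" and g: "\<And>x. x \<in> X \<Longrightarrow> g x \<in> carrier B"
  obtains h where "h \<in> alg_hom (free_alg X) B" "\<And>x. x \<in> X \<Longrightarrow> h (gen x) = g x"
proof -
  interpret B: kalgebra B by fact
  \<comment> \<open>Substitution takes values for all letters, so those outside \<open>X\<close> get the value zero.\<close>
  define g' where "g' x = (if x \<in> X then g x else \<zero>\<^bsub>B\<^esub>)" for x
  interpret kalgebra_point B g'
    by unfold_locales (use g in \<open>auto simp: g'_def\<close>)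
  show thesis
    by (rule that[of "free_eval B g'"]) (auto simp: free_eval_hom, simp add: g'_def)
qed

lemma free_alg_hom_unique:
  fixes B :: "('k::comm_ring_1, 'a) module" and X :: "'x set"
  assumes "kalgebra B" and "h \<in> alg_hom (free_alg X) B" and "h' \<in> alg_hom (free_alg X) B"
    and gens: "\<And>x. x \<in> X \<Longrightarrow> h (gen x) = h' (gen x)"
    and "p \<in> carrier (free_alg X)"
  shows "h p = h' p"
proof -
  interpret B: kalgebra B by fact
  interpret F: kalgebra "free_alg X" by (rule kalgebra_free_alg)
  interpret h: kalgebra_hom "free_alg X" B h by unfold_locales fact
  interpret h': kalgebra_hom "free_alg X" B h' by unfold_locales fact
  note hs = h.hom_mult h.hom_add h.hom_smult h.hom_one h.hom_zero
    h'.hom_mult h'.hom_add h'.hom_smult h'.hom_one h'.hom_zero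
  note homs = hs[unfolded free_alg_simps]
  let ?m = "\<lambda>xs. Poly_Mapping.single (Mon xs) 1 :: ('x, 'k) fpoly"
  have m_closed: "?m xs \<in> carrier (free_alg X)" if "set xs \<subseteq> X" for xs
    using that by (simp add: carrier_free_alg)
  have word: "h (?m xs) = h' (?m xs)" if "set xs \<subseteq> X" for xs
    using that
  proof (induction xs)
    case Nil
    have "?m [] = 1" by (simp flip: zero_fmon_def)
    then show ?case using homs by simp
  next
    case (Cons x xs)
    have "?m (x # xs) = gen x * ?m xs"
      by (simp add: gen_def mult_single plus_fmon_def)
    then show ?case using Cons by (simp add: homs gens m_closed)
  qed
  show ?thesis using assms(5)
  proof (induction p rule: fpoly_induct)
    case (add w c p)
    have "Poly_Mapping.single w c = scal c * ?m (letters w)"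
      by (simp add: scal_mult_single)
    moreover have "Poly_Mapping.single w c \<in> carrier (free_alg X)"
      using add.hyps(1) by (simp add: carrier_free_alg)
    ultimately show ?case using add word[of "letters w"] m_closed[of "letters w"]
      by (simp add: homs(2,3,5,7,8,10))
  qed (simp add: homs)
qed

section \<open>Quotient algebras\<close>

lemma quot_alg_simps:
  "carrier (quot_alg A I) = carrier (A Quot I)" "monoid.mult (quot_alg A I) = monoid.mult (A Quot I)"
  "one (quot_alg A I) = one (A Quot I)" "zero (quot_alg A I) = zero (A Quot I)"
  "add (quot_alg A I) = add (A Quot I)"
  by (simp_all add: quot_alg_def)

locale kalgebra_ideal = kalgebra A + ideal I A
  for A :: "('k::comm_ring_1, 'a) module" (structure) and I
begin

abbreviation proj :: "'a \<Rightarrow> 'a set" where "proj x \<equiv> I +> x"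

lemma quot_carrierE:
  assumes "S \<in> carrier (quot_alg A I)"
  obtains x where "x \<in> carrier A" "S = proj x"
  using assms by (auto simp: quot_alg_simps FactRing_simps)

lemma proj_closed [simp, intro]: "x \<in> carrier A \<Longrightarrow> proj x \<in> carrier (quot_alg A I)"
  using ring_hom_closed[OF rcos_ring_hom] by (simp add: quot_alg_simps)

lemma proj_eq_iff: "x \<in> carrier A \<Longrightarrow> y \<in> carrier A \<Longrightarrow> proj x = proj y \<longleftrightarrow> x \<ominus> y \<in> I"
  using quotient_eq_iff_same_a_r_cos[OF ideal_axioms] by simp

lemma smult_ideal: "x \<in> I \<Longrightarrow> c \<odot> x \<in> I"
  using I_l_closed[of x "c \<odot> \<one>"] a_subset by auto

text \<open>
Scalar multiplication on the quotient is defined as a union over all representatives. An ideal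
is stable under scalars, since \<open>c \<odot> x = (c \<odot> \<one>) \<otimes> x\<close>, so all members of this union coincide.
\<close>

lemma quot_smult:
  assumes "x \<in> carrier A"
  shows "c \<odot>\<^bsub>quot_alg A I\<^esub> proj x = proj (c \<odot> x)"
proof -
  have "proj (c \<odot> y) = proj (c \<odot> x)" if "y \<in> proj x" for y
  proof -
    have y: "y \<in> carrier A" using that assms a_r_coset_subset_G a_subset by blast
    have "proj y = proj x" using that assms a_repr_independence' by blast
    then have "c \<odot> (y \<ominus> x) \<in> I" using y assms smult_ideal by (simp add: proj_eq_iff)
    then show ?thesis using y assms by (simp add: proj_eq_iff smult_minus_distr)
  qed
  moreover have "x \<in> proj x" using assms a_rcos_self by blast
  ultimately have "(\<Union>y\<in>proj x. proj (c \<odot> y)) = proj (c \<odot> x)" by blast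
  then show ?thesis by (simp add: quot_alg_def)
qed

lemma proj_zero_iff: "x \<in> carrier A \<Longrightarrow> proj x = \<zero>\<^bsub>quot_alg A I\<^esub> \<longleftrightarrow> x \<in> I"
  using proj_eq_iff[of x \<zero>] a_coset_add_zero[OF a_subset]
  by (simp add: quot_alg_simps FactRing_def minus_eq)

lemma kalgebra_quot_alg: "kalgebra (quot_alg A I)"
proof -
  interpret Q: ring "A Quot I" by (rule quotient_is_ring)
  have "ring (quot_alg A I)"
  proof (rule ringI)
    show "abelian_group (quot_alg A I)"
    proof (rule abelian_groupI)
      fix x assume "x \<in> carrier (quot_alg A I)"
      then show "\<exists>y\<in>carrier (quot_alg A I). y \<oplus>\<^bsub>quot_alg A I\<^esub> x = \<zero>\<^bsub>quot_alg A I\<^esub>"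
        unfolding quot_alg_simps using Q.l_neg by blast
    qed (simp_all add: quot_alg_simps Q.a_ac)
    show "monoid (quot_alg A I)"
      by (rule monoidI) (simp_all add: quot_alg_simps Q.m_assoc)
  qed (simp_all add: quot_alg_simps Q.l_distr Q.r_distr)
  have mult: "proj x \<otimes>\<^bsub>quot_alg A I\<^esub> proj y = proj (x \<otimes> y)"
    and add: "proj x \<oplus>\<^bsub>quot_alg A I\<^esub> proj y = proj (x \<oplus> y)"
    if "x \<in> carrier A" "y \<in> carrier A" for x y
    using that rcos_ring_hom by (simp_all add: quot_alg_simps ring_hom_mult ring_hom_add)
  note ops = quot_smult mult add
  show "kalgebra (quot_alg A I)"
    by (intro kalgebra.intro kalgebra_axioms.intro \<open>ring (quot_alg A I)\<close>)
      (elim quot_carrierE, simp add: ops smult_l_distr smult_r_distr proj_closed)+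
qed

lemma proj_hom: "proj \<in> alg_hom A (quot_alg A I)"
  using rcos_ring_hom by (auto simp: alg_hom_def quot_smult ring_hom_def quot_alg_simps)

text \<open>
A homomorphism that vanishes on the ideal is constant on cosets, so it can be evaluated at any
representative.
\<close>

lemma quot_hom_exists:
  assumes "kalgebra B" "h \<in> alg_hom A B" "\<And>x. x \<in> I \<Longrightarrow> h x = \<zero>\<^bsub>B\<^esub>"
  obtains h' where "h' \<in> alg_hom (quot_alg A I) B" "\<And>x. x \<in> carrier A \<Longrightarrow> h' (proj x) = h x"
proof -
  interpret B: kalgebra B by fact
  interpret h: kalgebra_hom A B h by unfold_locales fact
  interpret Q: kalgebra "quot_alg A I" by (rule kalgebra_quot_alg)
  interpret p: kalgebra_hom A "quot_alg A I" proj by unfold_locales (rule proj_hom)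
  define h' where "h' S = h (SOME x. x \<in> carrier A \<and> S = proj x)" for S
  have h': "h' (proj x) = h x" if x: "x \<in> carrier A" for x
  proof -
    define y where "y = (SOME y. y \<in> carrier A \<and> proj x = proj y)"
    have y: "y \<in> carrier A" "proj x = proj y"
      using someI[of "\<lambda>y. y \<in> carrier A \<and> proj x = proj y" x] x by (auto simp: y_def)
    then have "h (x \<ominus> y) = \<zero>\<^bsub>B\<^esub>" using x proj_eq_iff by (intro assms(3)) blast
    then have "h x = h y" using x y by simp
    then show ?thesis by (simp only: h'_def y_def)
  qed
  have "h' \<in> alg_hom (quot_alg A I) B"
    unfolding alg_hom_def
  proof (intro CollectI conjI ring_hom_memI allI ballI; (elim quot_carrierE, hypsubst)?)
    show "h' \<one>\<^bsub>quot_alg A I\<^esub> = \<one>\<^bsub>B\<^esub>"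
      using h'[of \<one>] by simp
  qed (simp_all add: h' p.hom_mult[symmetric] p.hom_add[symmetric] p.hom_smult[symmetric]
      del: p.hom_mult p.hom_add p.hom_smult)
  with h' show thesis using that[of h'] by blast
qed

end

section \<open>Evaluating polynomials in an algebra\<close>

context kalgebra
begin

lemma alg_eval_degree_le:
  assumes "a \<in> carrier A" "degree p \<le> n"
  shows "alg_eval A p a = finsum A (\<lambda>i. coeff p i \<odot> (a [^] i)) {..n}"
  unfolding alg_eval_def using assms
  by (intro add.finprod_mono_neutral_cong_left) (auto simp: coeff_eq_0)

lemma alg_eval_closed [simp, intro]:
  "a \<in> carrier A \<Longrightarrow> alg_eval A p a \<in> carrier A"
  unfolding alg_eval_def by (rule finsum_closed) auto

lemma alg_eval_0 [simp]: "a \<in> carrier A \<Longrightarrow> alg_eval A 0 a = \<zero>"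
  by (simp add: alg_eval_def)

lemma alg_eval_pCons [simp]:
  assumes "a \<in> carrier A"
  shows "alg_eval A (pCons c p) a = c \<odot> \<one> \<oplus> a \<otimes> alg_eval A p a"
proof -
  have "alg_eval A (pCons c p) a =
      finsum A (\<lambda>i. coeff (pCons c p) i \<odot> (a [^] i)) {..Suc (degree p)}"
    using assms by (intro alg_eval_degree_le) (auto simp: degree_pCons_le)
  also have "\<dots> = finsum A (\<lambda>i. coeff p i \<odot> (a [^] Suc i)) {..degree p} \<oplus> c \<odot> \<one>"
    using assms by (subst finsum_Suc2) auto
  also have "finsum A (\<lambda>i. coeff p i \<odot> (a [^] Suc i)) {..degree p} = a \<otimes> alg_eval A p a"
    unfolding alg_eval_def using assms nat_pow_Suc2[OF assms]
    by (subst finsum_rdistr) (auto intro!: finsum_cong')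
  finally show ?thesis using assms by (simp add: a_comm)
qed

lemma alg_eval_add:
  assumes "a \<in> carrier A"
  shows "alg_eval A (p + q) a = alg_eval A p a \<oplus> alg_eval A q a"
proof -
  let ?n = "max (degree p) (degree q)"
  have "alg_eval A (p + q) a = finsum A (\<lambda>i. coeff (p + q) i \<odot> (a [^] i)) {..?n}"
    using assms by (intro alg_eval_degree_le) (auto simp: degree_add_le)
  also have "\<dots> = finsum A (\<lambda>i. coeff p i \<odot> (a [^] i) \<oplus> coeff q i \<odot> (a [^] i)) {..?n}"
    using assms by (intro finsum_cong') (auto simp: smult_l_distr)
  also have "\<dots> = finsum A (\<lambda>i. coeff p i \<odot> (a [^] i)) {..?n} \<oplus>
      finsum A (\<lambda>i. coeff q i \<odot> (a [^] i)) {..?n}"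
    using assms by (intro finsum_addf) auto
  finally show ?thesis
    using assms by (simp add: alg_eval_degree_le[of a p ?n] alg_eval_degree_le[of a q ?n])
qed

lemma alg_eval_smult:
  assumes "a \<in> carrier A"
  shows "alg_eval A (Polynomial.smult c p) a = c \<odot> alg_eval A p a"
  using assms by (induction p) (simp_all add: smult_r_distr)

lemma alg_eval_mult:
  assumes "a \<in> carrier A"
  shows "alg_eval A (p * q) a = alg_eval A p a \<otimes> alg_eval A q a"
  using assms
  by (induction p) (simp_all add: alg_eval_add alg_eval_smult l_distr m_assoc)

lemma alg_eval_sum:
  assumes "a \<in> carrier A" "finite S"
  shows "alg_eval A (\<Sum>i\<in>S. p i) a = finsum A (\<lambda>i. alg_eval A (p i) a) S"
  using assms(2,1)
proof (induction S rule: finite_induct)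
  case (insert i S)
  then have "(\<lambda>i. alg_eval A (p i) a) \<in> S \<rightarrow> carrier A" by auto
  with insert show ?case by (simp add: alg_eval_add)
qed simp

text \<open>
This is what makes polynomials in a diagonal element computable: on the \<open>j\<close>-th idempotent they
act through their values at the \<open>j\<close>-th eigenvalue.
\<close>

lemma alg_eval_eigenvector:
  assumes "a \<in> carrier A" "y \<in> carrier A" "a \<otimes> y = c \<odot> y"
  shows "alg_eval A p a \<otimes> y = poly p c \<odot> y"
  using assms(1,2)
proof (induction p)
  case (pCons b p)
  then have "alg_eval A (pCons b p) a \<otimes> y = b \<odot> y \<oplus> a \<otimes> (alg_eval A p a \<otimes> y)"
    by (simp add: l_distr m_assoc)
  with pCons assms(3) show ?case by (simp add: smult_l_distr mult.commute)
qed simp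

lemma alg_eval_commute:
  assumes "a \<in> carrier A" "y \<in> carrier A" "y \<otimes> a = a \<otimes> y"
  shows "y \<otimes> alg_eval A p a = alg_eval A p a \<otimes> y"
  using assms(1,2)
proof (induction p)
  case (pCons b p)
  have "y \<otimes> (a \<otimes> alg_eval A p a) = a \<otimes> (y \<otimes> alg_eval A p a)"
    using pCons.prems assms(3) by (simp flip: m_assoc)
  with pCons show ?case by (simp add: l_distr r_distr m_assoc)
qed simp

end

lemma (in kalgebra_hom) hom_alg_eval [simp]:
  "a \<in> carrier A \<Longrightarrow> h (alg_eval A p a) = alg_eval B p (h a)"
  by (induction p) auto

lemma prod_linear_dvd:
  fixes c :: "'i \<Rightarrow> 'k::field"
  assumes "finite S" "inj_on c S" "\<And>i. i \<in> S \<Longrightarrow> poly p (c i) = 0"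
  shows "(\<Prod>i\<in>S. [:- c i, 1:]) dvd p"
  using assms
proof (induction S arbitrary: p rule: finite_induct)
  case (insert i S)
  then obtain q where q: "p = [:- c i, 1:] * q"
    by (metis dvdE insertI1 poly_eq_0_iff_dvd)
  have "poly q (c j) = 0" if "j \<in> S" for j
  proof -
    have "c j \<noteq> c i" using insert.prems(1) insert.hyps that by (auto simp: inj_on_def)
    with insert.prems(2)[of j] that show ?thesis by (simp add: q)
  qed
  then have "(\<Prod>i\<in>S. [:- c i, 1:]) dvd q" using insert by auto
  then show ?case using insert.hyps by (simp add: q mult_dvd_mono del: mult_pCons_left)
qed simp

section \<open>Algebras with a complete family of orthogonal idempotents\<close>

text \<open>
The diagonal elements with respect to the family \<open>E\<close>: in \<open>c j\<close> one reads off the eigenvalue on the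
\<open>j\<close>-th idempotent.
\<close>

definition diag :: "('k, 'a) module \<Rightarrow> nat \<Rightarrow> (int \<Rightarrow> 'a) \<Rightarrow> (int \<Rightarrow> 'k) \<Rightarrow> 'a" where
  "diag A d E c = finsum A (\<lambda>r. c (int r) \<odot>\<^bsub>A\<^esub> E (int r)) {0..d}"

text \<open>
The idempotents are indexed by all integers and vanish outside \<open>{0..d}\<close>. This keeps the relations
that shift the index by one free of boundary cases.
\<close>

locale spectral_algebra = kalgebra A
  for A :: "('k::field, 'a) module" (structure) +
  fixes d :: nat and E :: "int \<Rightarrow> 'a"
  assumes E_closed [simp, intro]: "E i \<in> carrier A"
    and E_outside: "i < 0 \<or> int d < i \<Longrightarrow> E i = \<zero>"
    and E_mult [simp]: "E i \<otimes> E j = (if i = j then E i else \<zero>)"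
    and E_sum: "finsum A (\<lambda>r. E (int r)) {0..d} = \<one>"
begin

text \<open>
The idempotents add up to \<open>\<one>\<close>, so an element is determined by its products with them. This rule
and its mirror image reduce an identity to one idempotent at a time.
\<close>

lemma eqI_right:
  assumes "x \<in> carrier A" "y \<in> carrier A"
    and "\<And>j. 0 \<le> j \<Longrightarrow> j \<le> int d \<Longrightarrow> x \<otimes> E j = y \<otimes> E j"
  shows "x = y"
proof -
  have "z = finsum A (\<lambda>r. z \<otimes> E (int r)) {0..d}" if "z \<in> carrier A" for z
    using that by (subst finsum_rdistr[symmetric]) (auto simp: E_sum)
  moreover have "finsum A (\<lambda>r. x \<otimes> E (int r)) {0..d} = finsum A (\<lambda>r. y \<otimes> E (int r)) {0..d}"
    using assms by (intro finsum_cong') auto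
  ultimately show ?thesis using assms(1,2) by metis
qed

lemma eqI_left:
  assumes "x \<in> carrier A" "y \<in> carrier A"
    and "\<And>j. 0 \<le> j \<Longrightarrow> j \<le> int d \<Longrightarrow> E j \<otimes> x = E j \<otimes> y"
  shows "x = y"
proof -
  have "z = finsum A (\<lambda>r. E (int r) \<otimes> z) {0..d}" if "z \<in> carrier A" for z
    using that by (subst finsum_ldistr[symmetric]) (auto simp: E_sum)
  moreover have "finsum A (\<lambda>r. E (int r) \<otimes> x) {0..d} = finsum A (\<lambda>r. E (int r) \<otimes> y) {0..d}"
    using assms by (intro finsum_cong') auto
  ultimately show ?thesis using assms(1,2) by metis
qed

lemma diag_closed [simp, intro]: "diag A d E c \<in> carrier A"
  unfolding diag_def by (rule finsum_closed) auto

lemma diag_E [simp]: "diag A d E c \<otimes> E j = c j \<odot> E j"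
proof (cases "0 \<le> j \<and> j \<le> int d")
  case True
  have "diag A d E c \<otimes> E j = finsum A (\<lambda>r. (c (int r) \<odot> E (int r)) \<otimes> E j) {0..d}"
    unfolding diag_def by (subst finsum_ldistr) auto
  also have "\<dots> = finsum A (\<lambda>r. if nat j = r then c j \<odot> E j else \<zero>) {0..d}"
    using True by (intro finsum_cong') auto
  also have "\<dots> = c j \<odot> E j"
    using True by (subst finsum_singleton) auto
  finally show ?thesis .
next
  case False
  then have "E j = \<zero>" by (intro E_outside) linarith
  then show ?thesis by simp
qed

lemma E_diag [simp]: "E j \<otimes> diag A d E c = c j \<odot> E j"
  by (rule eqI_right) (auto simp: m_assoc)

lemma eq_diagI:
  assumes "x \<in> carrier A" "\<And>j. 0 \<le> j \<Longrightarrow> j \<le> int d \<Longrightarrow> x \<otimes> E j = c j \<odot> E j"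
  shows "x = diag A d E c"
  by (rule eqI_right) (use assms in auto)

lemma alg_eval_diag: "alg_eval A p (diag A d E c) = diag A d E (\<lambda>j. poly p (c j))"
  by (rule eq_diagI) (auto intro: alg_eval_eigenvector)

text \<open>
An element that commutes with \<open>diag A d E c\<close> up to the factor \<open>q\<close> maps the eigenspace of
\<open>c j\<close> to that of \<open>q * c j\<close>. In terms of blocks, evaluating \<open>E i \<otimes> diag A d E c \<otimes> x \<otimes> E m\<close>
directly, or after moving the diagonal factor past \<open>x\<close>, gives the block \<open>E i \<otimes> x \<otimes> E m\<close> with the
factor \<open>c i\<close> or \<open>q * c m\<close>, so this block is zero unless \<open>i = m + t\<close>.
\<close>

lemma shifts_idempotents:
  assumes x: "x \<in> carrier A" and q: "diag A d E c \<otimes> x = q \<odot> (x \<otimes> diag A d E c)"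
    and c: "\<And>i j. c i = q * c j \<longleftrightarrow> i = j + t"
  shows "x \<otimes> E j = E (j + t) \<otimes> x"
proof -
  have 0: "E i \<otimes> x \<otimes> E m = \<zero>" if "i \<noteq> m + t" for i m
  proof -
    have "c i \<odot> (E i \<otimes> x \<otimes> E m) = E i \<otimes> (diag A d E c \<otimes> x) \<otimes> E m"
      using x by (simp flip: m_assoc)
    also have "\<dots> = (q * c m) \<odot> (E i \<otimes> x \<otimes> E m)"
      using x unfolding q by (simp add: m_assoc)
    finally have "(c i - q * c m) \<odot> (E i \<otimes> x \<otimes> E m) = \<zero>"
      using x by (simp add: smult_diff)
    then have "(inverse (c i - q * c m) * (c i - q * c m)) \<odot> (E i \<otimes> x \<otimes> E m) = \<zero>"
      using x by (simp flip: smult_smult)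
    then show ?thesis using that c x by simp
  qed
  show ?thesis
  proof (rule eqI_left, use x in simp, use x in simp, rule eqI_right)
    fix i m
    have "E i \<otimes> (x \<otimes> E j) \<otimes> E m = (if j = m then E i \<otimes> x \<otimes> E m else \<zero>)"
      using x by (simp add: m_assoc)
    moreover have "E i \<otimes> (E (j + t) \<otimes> x) \<otimes> E m = (if i = j + t then E i \<otimes> x \<otimes> E m else \<zero>)"
      using x by (simp flip: m_assoc)
    ultimately show "E i \<otimes> (x \<otimes> E j) \<otimes> E m = E i \<otimes> (E (j + t) \<otimes> x) \<otimes> E m"
      using 0[of i m] by auto
  qed (use x in auto)
qed

end

section \<open>The scalars\<close>

lemma qv_power: "qv ^ n = Fraction_Field.Fract (Polynomial.monom 1 n) 1"
  by (induction n) (simp_all add: qv_def One_fract_def monom_Suc mult.commute)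

lemma qv_nonzero [simp]: "qv \<noteq> 0"
  by (simp add: qv_def Zero_fract_def eq_fract)

text \<open>
That \<open>qv\<close> is not a root of unity is what makes the weights \<open>qalpha d r\<close> pairwise distinct.
\<close>

lemma qv_power_eq_1_iff [simp]: "qv ^ n = 1 \<longleftrightarrow> n = 0"
proof -
  have "n = 0" if "Polynomial.monom (1::complex) n = 1"
    using arg_cong[OF that, of degree] by (simp add: degree_monom_eq)
  then show ?thesis by (auto simp: qv_power One_fract_def eq_fract)
qed

lemma qv_powi_eq_1_iff: "qv powi i = 1 \<longleftrightarrow> i = 0"
  by (auto simp: power_int_def power_inverse)

lemma qv_powi_inject [simp]: "qv powi i = qv powi j \<longleftrightarrow> i = j"
proof -
  have "qv powi i = qv powi (i - j) * qv powi j" by (simp flip: power_int_add)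
  then show ?thesis using qv_powi_eq_1_iff[of "i - j"] by auto
qed

section \<open>The defining relations\<close>

text \<open>
The relations of the two presentations, read as identities between elements of an arbitrary
algebra. Those that involve neither \<open>k\<close> nor the idempotents are common to both presentations and
form a predicate of their own.
\<close>

definition mirabolic_relations :: "(ratfun, 'a) module \<Rightarrow> 'a \<Rightarrow> 'a \<Rightarrow> 'a \<Rightarrow> bool" where
  "mirabolic_relations B e f l \<longleftrightarrow>
    l \<otimes>\<^bsub>B\<^esub> l = l \<and>
    l \<otimes>\<^bsub>B\<^esub> e \<otimes>\<^bsub>B\<^esub> l = l \<otimes>\<^bsub>B\<^esub> e \<and>
    l \<otimes>\<^bsub>B\<^esub> f \<otimes>\<^bsub>B\<^esub> l = f \<otimes>\<^bsub>B\<^esub> l \<and>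
    qint 2 \<odot>\<^bsub>B\<^esub> (e \<otimes>\<^bsub>B\<^esub> l \<otimes>\<^bsub>B\<^esub> e) =
      inverse qv \<odot>\<^bsub>B\<^esub> (e \<otimes>\<^bsub>B\<^esub> e \<otimes>\<^bsub>B\<^esub> l) \<oplus>\<^bsub>B\<^esub> qv \<odot>\<^bsub>B\<^esub> (l \<otimes>\<^bsub>B\<^esub> (e \<otimes>\<^bsub>B\<^esub> e)) \<and>
    qint 2 \<odot>\<^bsub>B\<^esub> (f \<otimes>\<^bsub>B\<^esub> l \<otimes>\<^bsub>B\<^esub> f) =
      inverse qv \<odot>\<^bsub>B\<^esub> (l \<otimes>\<^bsub>B\<^esub> (f \<otimes>\<^bsub>B\<^esub> f)) \<oplus>\<^bsub>B\<^esub> qv \<odot>\<^bsub>B\<^esub> (f \<otimes>\<^bsub>B\<^esub> f \<otimes>\<^bsub>B\<^esub> l)"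

definition mir_relations :: "(ratfun, 'a) module \<Rightarrow> (mir_gen \<Rightarrow> 'a) \<Rightarrow> bool" where
  "mir_relations B g \<longleftrightarrow>
    (let e = g Mir_e; f = g Mir_f; k = g Mir_k; k' = g Mir_kinv; l = g Mir_l in
      k \<otimes>\<^bsub>B\<^esub> k' = \<one>\<^bsub>B\<^esub> \<and> k' \<otimes>\<^bsub>B\<^esub> k = \<one>\<^bsub>B\<^esub> \<and>
      k \<otimes>\<^bsub>B\<^esub> e \<otimes>\<^bsub>B\<^esub> k' = qv ^ 2 \<odot>\<^bsub>B\<^esub> e \<and>
      k \<otimes>\<^bsub>B\<^esub> f \<otimes>\<^bsub>B\<^esub> k' = qv powi (-2) \<odot>\<^bsub>B\<^esub> f \<and>
      e \<otimes>\<^bsub>B\<^esub> f \<ominus>\<^bsub>B\<^esub> f \<otimes>\<^bsub>B\<^esub> e = (1 / (qv - inverse qv)) \<odot>\<^bsub>B\<^esub> (k \<ominus>\<^bsub>B\<^esub> k') \<and>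
      k \<otimes>\<^bsub>B\<^esub> l = l \<otimes>\<^bsub>B\<^esub> k \<and>
      mirabolic_relations B e f l)"

definition cut_relations :: "(ratfun, 'a) module \<Rightarrow> nat \<Rightarrow> 'a \<Rightarrow> 'a \<Rightarrow> bool" where
  "cut_relations B d k l \<longleftrightarrow>
    alg_eval B (P_poly d) k = \<zero>\<^bsub>B\<^esub> \<and>
    (l \<ominus>\<^bsub>B\<^esub> \<one>\<^bsub>B\<^esub>) \<otimes>\<^bsub>B\<^esub> alg_eval B (Q_poly d) k = \<zero>\<^bsub>B\<^esub>"

definition id_relations ::
  "(ratfun, 'a) module \<Rightarrow> nat \<Rightarrow> 'a \<Rightarrow> 'a \<Rightarrow> 'a \<Rightarrow> (int \<Rightarrow> 'a) \<Rightarrow> bool" where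
  "id_relations B d e f l E \<longleftrightarrow>
    (\<forall>j. j < 0 \<or> int d < j \<longrightarrow> E j = \<zero>\<^bsub>B\<^esub>) \<and>
    (\<forall>r s. r \<le> d \<and> s \<le> d \<longrightarrow>
      E (int r) \<otimes>\<^bsub>B\<^esub> E (int s) = (if r = s then E (int r) else \<zero>\<^bsub>B\<^esub>)) \<and>
    finsum B (\<lambda>r. E (int r)) {0..d} = \<one>\<^bsub>B\<^esub> \<and>
    (\<forall>r. r \<le> d \<longrightarrow> e \<otimes>\<^bsub>B\<^esub> E (int r) = E (int r + 1) \<otimes>\<^bsub>B\<^esub> e) \<and>
    (\<forall>r. r \<le> d \<longrightarrow> f \<otimes>\<^bsub>B\<^esub> E (int r) = E (int r - 1) \<otimes>\<^bsub>B\<^esub> f) \<and>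
    e \<otimes>\<^bsub>B\<^esub> f \<ominus>\<^bsub>B\<^esub> f \<otimes>\<^bsub>B\<^esub> e = diag B d E (\<lambda>j. qint (2 * j - int d)) \<and>
    (\<forall>r. r \<le> d \<longrightarrow> l \<otimes>\<^bsub>B\<^esub> E (int r) = E (int r) \<otimes>\<^bsub>B\<^esub> l) \<and>
    l \<otimes>\<^bsub>B\<^esub> E 0 = E 0 \<and>
    mirabolic_relations B e f l"

locale free_alg_hom = B: kalgebra B
  for X :: "'x set" and B :: "('k::comm_ring_1, 'a) module" +
  fixes h
  assumes free_hom: "h \<in> alg_hom (free_alg X) B"
begin

sublocale kalgebra_hom "free_alg X" B h
  by (intro kalgebra_hom.intro kalgebra_hom_axioms.intro kalgebra_free_alg B.kalgebra_axioms free_hom)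

lemma fpoly_hom:
  assumes "p \<in> carrier (free_alg X)" "q \<in> carrier (free_alg X)"
  shows "h (p + q) = h p \<oplus>\<^bsub>B\<^esub> h q" "h (p * q) = h p \<otimes>\<^bsub>B\<^esub> h q" "h (p - q) = h p \<ominus>\<^bsub>B\<^esub> h q"
  using hom_add[OF assms] hom_mult[OF assms] hom_minus[OF assms] assms
  by (simp_all add: free_alg_simps)

lemma fpoly_hom_const: "h 0 = \<zero>\<^bsub>B\<^esub>" "h 1 = \<one>\<^bsub>B\<^esub>" "h (scal c) = c \<odot>\<^bsub>B\<^esub> \<one>\<^bsub>B\<^esub>"
  using hom_zero hom_one hom_smult[of 1 c] by (simp_all add: free_alg_simps)

lemma fpoly_hom_sum:
  assumes "finite S" "\<And>i. i \<in> S \<Longrightarrow> p i \<in> carrier (free_alg X)"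
  shows "(\<Sum>i\<in>S. p i) \<in> carrier (free_alg X) \<and> h (\<Sum>i\<in>S. p i) = finsum B (\<lambda>i. h (p i)) S"
  using assms
proof (induction S rule: finite_induct)
  case (insert i S)
  then have "(\<lambda>i. h (p i)) \<in> S \<rightarrow> carrier B" by auto
  with insert show ?case by (simp add: fpoly_hom free_alg_closed)
qed (simp add: fpoly_hom_const)

end

lemma free_alg_UNIV [simp]: "p \<in> carrier (free_alg UNIV)"
  by (simp add: carrier_free_alg)

lemma id_gens_simps [simp]:
  "Id_e \<in> id_gens d" "Id_f \<in> id_gens d" "Id_l \<in> id_gens d" "r \<le> d \<Longrightarrow> Id_eps r \<in> id_gens d"
  by (auto simp: id_gens_def)

lemma eps_gen_closed [simp]: "eps_gen d j \<in> carrier (free_alg (id_gens d))"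
  by (simp add: eps_gen_def nat_le_iff)

text \<open>
This equivalence is needed in both directions: for the projection onto a quotient it yields the
relations between the generators, and for an evaluation homomorphism it yields the vanishing that
lets the homomorphism factor through the quotient.
\<close>

lemma mir_rels_vanish_iff:
  assumes "free_alg_hom UNIV B h"
  shows "(\<forall>r\<in>mir_rels. h r = \<zero>\<^bsub>B\<^esub>) \<longleftrightarrow> mir_relations B (\<lambda>x. h (gen x))"
proof -
  interpret free_alg_hom UNIV B h by fact
  show ?thesis
    unfolding mir_rels_def mir_relations_def mirabolic_relations_def Let_def
    by (simp add: fpoly_hom fpoly_hom_const power2_eq_square conj_ac)
qed

lemma ball_Collect1: "(\<forall>x\<in>{g r |r. R r}. T x) \<longleftrightarrow> (\<forall>r. R r \<longrightarrow> T (g r))"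
  by blast

lemma ball_Collect2: "(\<forall>x\<in>{g r s |r s. R r s}. T x) \<longleftrightarrow> (\<forall>r s. R r s \<longrightarrow> T (g r s))"
  by blast

lemma id_rels_vanish_iff:
  assumes "free_alg_hom (id_gens d) B h"
  shows "(\<forall>r\<in>id_rels d. h r = \<zero>\<^bsub>B\<^esub>) \<longleftrightarrow>
    id_relations B d (h (gen Id_e)) (h (gen Id_f)) (h (gen Id_l)) (\<lambda>j. h (eps_gen d j))"
proof -
  interpret free_alg_hom "id_gens d" B h by fact
  have out: "h (eps_gen d j) = \<zero>\<^bsub>B\<^esub>" if "j < 0 \<or> int d < j" for j
    using that by (auto simp: eps_gen_def fpoly_hom_const)
  note sums = fpoly_hom_sum[THEN conjunct1] fpoly_hom_sum[THEN conjunct2]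
  have "finsum B (\<lambda>r. c r \<odot>\<^bsub>B\<^esub> h (eps_gen d (int r))) {0..d} \<in> carrier B" for c
    by (rule B.finsum_closed) auto
  moreover have "finsum B (\<lambda>r. h (eps_gen d (int r))) {0..d} \<in> carrier B"
    by (rule B.finsum_closed) auto
  ultimately show ?thesis
    unfolding id_rels_def id_relations_def mirabolic_relations_def Let_def diag_def
      ball_Un ball_Collect1 ball_Collect2
    using out
    by (simp add: fpoly_hom fpoly_hom_const sums power2_eq_square free_alg_closed
        if_distrib[of h] if_distrib[of "\<lambda>x. x \<in> carrier B"]
        if_distrib[of "\<lambda>x. x \<in> carrier (free_alg (id_gens d))"] cong: if_cong)
      blast
qed

section \<open>From a diagonalizable \<open>k\<close> to its spectral idempotents\<close>

abbreviation weight :: "nat \<Rightarrow> int \<Rightarrow> ratfun" where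
  "weight d j \<equiv> qv powi (2 * j - int d)"

lemma weight_shift: "weight d i = qv powi (2 * t) * weight d j \<longleftrightarrow> i = j + t"
proof -
  have "qv powi (2 * t) * weight d j = weight d (j + t)"
    by (subst power_int_add[symmetric]) (simp_all add: algebra_simps)
  then show ?thesis by simp presburger
qed

lemma qalpha_weight: "qalpha d r = weight d (int r)"
  by (simp add: qalpha_def)

lemma inj_qalpha: "inj_on (qalpha d) S"
  by (auto simp: inj_on_def qalpha_def)

lemma poly_L: "r \<le> d \<Longrightarrow> s \<le> d \<Longrightarrow> poly (L_poly d r) (qalpha d s) = (if r = s then 1 else 0)"
  using inj_qalpha[of d UNIV]
  by (auto simp: L_poly_def poly_prod inj_eq intro!: prod.neutral simp flip: diff_divide_distrib)

lemma poly_P: "s \<le> d \<Longrightarrow> poly (P_poly d) (qalpha d s) = 0"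
  by (auto simp: P_poly_def poly_prod)

text \<open>
Since \<open>Q\<close> vanishes at all weights except the lowest one, \<open>Q(k)\<close> is a nonzero multiple of the
idempotent of index \<open>0\<close>. This turns \<open>(l - 1) Q(k) = 0\<close> into \<open>l \<epsilon>\<^sub>0 = \<epsilon>\<^sub>0\<close>.
\<close>

lemma poly_Q: "s \<le> d \<Longrightarrow> poly (Q_poly d) (qalpha d s) = 0 \<longleftrightarrow> s \<noteq> 0"
  using inj_qalpha[of d UNIV] by (auto simp: Q_poly_def poly_prod inj_eq)

definition lagrange_idem :: "(ratfun, 'a) module \<Rightarrow> nat \<Rightarrow> 'a \<Rightarrow> int \<Rightarrow> 'a" where
  "lagrange_idem B d k j =
    (if 0 \<le> j \<and> j \<le> int d then alg_eval B (L_poly d (nat j)) k else \<zero>\<^bsub>B\<^esub>)"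

locale cut_kalgebra = kalgebra A for A :: "(ratfun, 'a) module" (structure) +
  fixes d :: nat and k :: 'a
  assumes k_closed [simp, intro]: "k \<in> carrier A"
    and P_zero: "alg_eval A (P_poly d) k = \<zero>"
begin

text \<open>
\<open>P\<close> has the pairwise distinct roots \<open>qalpha d s\<close>, so it divides every polynomial that vanishes at
all of them. Hence \<open>p(k)\<close> depends only on the values of \<open>p\<close> at the weights. Each polynomial identity
for the Lagrange idempotents thus reduces to comparing values.
\<close>

lemma alg_eval_cong:
  assumes "\<And>s. s \<le> d \<Longrightarrow> poly p (qalpha d s) = poly q (qalpha d s)"
  shows "alg_eval A p k = alg_eval A q k"
proof -
  have "P_poly d dvd p - q"
    unfolding P_poly_def using assms inj_qalpha by (intro prod_linear_dvd) auto
  then obtain t where "p = q + P_poly d * t" by (metis dvdE diff_add_cancel add.commute)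
  then show ?thesis by (simp add: alg_eval_add alg_eval_mult P_zero)
qed

sublocale spectral_algebra A d "lagrange_idem A d k"
proof unfold_locales
  show "lagrange_idem A d k i \<in> carrier A" for i
    by (simp add: lagrange_idem_def)
  show "lagrange_idem A d k i = \<zero>" if "i < 0 \<or> int d < i" for i
    using that by (auto simp: lagrange_idem_def)
  have "alg_eval A (L_poly d r) k \<otimes> alg_eval A (L_poly d s) k =
      alg_eval A (if r = s then L_poly d r else 0) k" if "r \<le> d" "s \<le> d" for r s
    unfolding alg_eval_mult[OF k_closed, symmetric]
    using that by (intro alg_eval_cong) (simp add: poly_L)
  then show "lagrange_idem A d k i \<otimes> lagrange_idem A d k j =
      (if i = j then lagrange_idem A d k i else \<zero>)" for i j
    by (auto simp: lagrange_idem_def nat_le_iff eq_nat_nat_iff)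
  have "finsum A (\<lambda>r. lagrange_idem A d k (int r)) {0..d} =
      finsum A (\<lambda>r. alg_eval A (L_poly d r) k) {0..d}"
    by (intro finsum_cong') (auto simp: lagrange_idem_def)
  also have "\<dots> = alg_eval A (\<Sum>r = 0..d. L_poly d r) k"
    by (simp add: alg_eval_sum)
  also have "\<dots> = alg_eval A 1 k"
    by (intro alg_eval_cong) (simp add: poly_sum poly_L)
  also have "\<dots> = \<one>"
    by (simp add: one_pCons)
  finally show "finsum A (\<lambda>r. lagrange_idem A d k (int r)) {0..d} = \<one>" .
qed

lemma k_diag: "k = diag A d (lagrange_idem A d k) (weight d)"
proof (rule eq_diagI)
  fix j assume j: "0 \<le> j" "j \<le> int d"
  then obtain r where r: "j = int r" "r \<le> d" by (metis nat_le_iff nonneg_int_cases of_nat_le_iff)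
  have "k \<otimes> alg_eval A (L_poly d r) k = alg_eval A ([:0, 1:] * L_poly d r) k"
    by (subst alg_eval_mult) auto
  also have "\<dots> = alg_eval A (Polynomial.smult (qalpha d r) (L_poly d r)) k"
    using r by (intro alg_eval_cong) (simp add: poly_L)
  also have "\<dots> = qalpha d r \<odot> alg_eval A (L_poly d r) k"
    by (simp add: alg_eval_smult)
  finally show "k \<otimes> lagrange_idem A d k j = weight d j \<odot> lagrange_idem A d k j"
    using r by (simp add: lagrange_idem_def qalpha_weight)
qed simp

end

text \<open>
Both presentations give the same commutator of \<open>e\<close> and \<open>f\<close>, because on the \<open>j\<close>-th block \<open>k\<close> acts as
the power of \<open>v\<close> with exponent \<open>2 * j - d\<close>, and \<open>(v\<^sup>m - v\<^sup>-\<^sup>m) / (v - v\<^sup>-\<^sup>1)\<close> is the quantum integer of \<open>m\<close>.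
\<close>

lemma qint_diag:
  fixes A (structure)
  assumes "spectral_algebra A d E"
  shows "(1 / (qv - inverse qv)) \<odot>
      (diag A d E (weight d) \<ominus> diag A d E (\<lambda>j. inverse (weight d j))) =
    diag A d E (\<lambda>j. qint (2 * j - int d))"
proof -
  interpret spectral_algebra A d E by fact
  show ?thesis
  proof (rule eq_diagI)
    fix j
    have "(diag A d E (weight d) \<ominus> diag A d E (\<lambda>j. inverse (weight d j))) \<otimes> E j =
        (weight d j - inverse (weight d j)) \<odot> E j"
      by (simp add: minus_eq l_distr l_minus smult_diff)
    moreover have "qint (2 * j - int d) = (weight d j - inverse (weight d j)) / (qv - inverse qv)"
      by (simp only: qint_def power_int_minus)
    ultimately show "(1 / (qv - inverse qv)) \<odot>
        (diag A d E (weight d) \<ominus> diag A d E (\<lambda>j. inverse (weight d j))) \<otimes> E j =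
        qint (2 * j - int d) \<odot> E j"
      by simp
  qed simp
qed

text \<open>
Since \<open>P\<close> has distinct roots, \<open>k\<close> is diagonal in its Lagrange idempotents. The conjugation
relations then become index shifts by \<open>shifts_idempotents\<close>, an element that commutes with \<open>k\<close>
commutes with all polynomials in \<open>k\<close>, and the relation with \<open>Q\<close> singles out the lowest idempotent.
The two formulas for \<open>k\<close> and its inverse are needed later, to recover
these generators from the idempotents.
\<close>

lemma mir_imp_id:
  fixes A (structure)
  assumes "kalgebra A" and g: "\<And>x. g x \<in> carrier A"
    and mir: "mir_relations A g" and cut: "cut_relations A d (g Mir_k) (g Mir_l)"
  defines "E \<equiv> lagrange_idem A d (g Mir_k)"
  shows "id_relations A d (g Mir_e) (g Mir_f) (g Mir_l) E"
    and "g Mir_k = diag A d E (weight d)"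
    and "g Mir_kinv = diag A d E (\<lambda>j. inverse (weight d j))"
proof -
  interpret cut_kalgebra A d "g Mir_k"
    using assms by (intro cut_kalgebra.intro cut_kalgebra_axioms.intro) (auto simp: cut_relations_def)
  define e f k k' l where "e = g Mir_e" "f = g Mir_f" "k = g Mir_k" "k' = g Mir_kinv" "l = g Mir_l"
  note defs = this
  have cl [simp, intro]: "e \<in> carrier A" "f \<in> carrier A" "k \<in> carrier A" "k' \<in> carrier A"
    "l \<in> carrier A" "\<And>j. E j \<in> carrier A"
    using g by (auto simp: defs E_def)
  have kk': "k \<otimes> k' = \<one>" and k'k: "k' \<otimes> k = \<one>"
    and ke: "k \<otimes> e \<otimes> k' = qv ^ 2 \<odot> e" and kf: "k \<otimes> f \<otimes> k' = qv powi (-2) \<odot> f"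
    and ef: "e \<otimes> f \<ominus> f \<otimes> e = (1 / (qv - inverse qv)) \<odot> (k \<ominus> k')"
    and kl: "k \<otimes> l = l \<otimes> k" and mirabolic: "mirabolic_relations A e f l"
    using mir unfolding mir_relations_def Let_def defs by blast+
  have k: "k = diag A d E (weight d)"
    unfolding defs E_def by (rule k_diag)
  have kE: "k \<otimes> E j = weight d j \<odot> E j" for j
    unfolding k by (simp add: E_def)
  have k'E: "k' \<otimes> E j = inverse (weight d j) \<odot> E j" for j
  proof -
    have "E j = (k' \<otimes> k) \<otimes> E j" by (simp add: k'k)
    also have "\<dots> = weight d j \<odot> (k' \<otimes> E j)" by (simp add: m_assoc kE)
    finally have "inverse (weight d j) \<odot> E j = inverse (weight d j) \<odot> (weight d j \<odot> (k' \<otimes> E j))"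
      by simp
    then show ?thesis by simp
  qed
  have k': "k' = diag A d E (\<lambda>j. inverse (weight d j))"
    using k'E unfolding E_def by (intro eq_diagI) auto
  then show "g Mir_kinv = diag A d E (\<lambda>j. inverse (weight d j))" by (simp only: defs)
  show "g Mir_k = diag A d E (weight d)" using k by (simp only: defs)
  \<comment> \<open>Multiplying by \<open>k\<close> on the right turns a conjugation relation into a commutation relation.\<close>
  have q_commute: "diag A d E (weight d) \<otimes> x = q \<odot> (x \<otimes> diag A d E (weight d))"
    if "x \<in> carrier A" "k \<otimes> x \<otimes> k' = q \<odot> x" for x q
  proof -
    have "k \<otimes> x = k \<otimes> x \<otimes> k' \<otimes> k" using that(1) by (simp add: m_assoc k'k)
    then show ?thesis using that by (simp flip: k)
  qed
  have eE: "e \<otimes> E j = E (j + 1) \<otimes> e" for j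
    unfolding E_def
  proof (rule shifts_idempotents)
    show "diag A d (lagrange_idem A d (g Mir_k)) (weight d) \<otimes> e =
        qv ^ 2 \<odot> (e \<otimes> diag A d (lagrange_idem A d (g Mir_k)) (weight d))"
      using q_commute[OF _ ke] by (simp add: E_def)
    show "weight d i = qv ^ 2 * weight d j \<longleftrightarrow> i = j + 1" for i j
      using weight_shift[of i d 1 j] by simp
  qed simp
  have fE: "f \<otimes> E j = E (j + (- 1)) \<otimes> f" for j
    unfolding E_def
  proof (rule shifts_idempotents)
    show "diag A d (lagrange_idem A d (g Mir_k)) (weight d) \<otimes> f =
        qv powi (-2) \<odot> (f \<otimes> diag A d (lagrange_idem A d (g Mir_k)) (weight d))"
      using q_commute[OF _ kf] by (simp add: E_def)
    show "weight d i = qv powi (-2) * weight d j \<longleftrightarrow> i = j + (- 1)" for i j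
      using weight_shift[of i d "- 1" j] by simp
  qed simp
  have commutator: "e \<otimes> f \<ominus> f \<otimes> e = diag A d E (\<lambda>j. qint (2 * j - int d))"
    unfolding ef k k' by (rule qint_diag) (simp add: E_def spectral_algebra_axioms)
  have lE: "l \<otimes> E j = E j \<otimes> l" for j
    using kl by (auto simp: E_def lagrange_idem_def intro!: alg_eval_commute simp flip: defs)
  have lE0: "l \<otimes> E 0 = E 0"
  proof -
    let ?q = "poly (Q_poly d) (weight d 0)"
    have q: "?q \<noteq> 0" using poly_Q[of 0 d] by (simp add: qalpha_def)
    have "(l \<ominus> \<one>) \<otimes> alg_eval A (Q_poly d) k \<otimes> E 0 = \<zero>"
      using cut by (simp add: cut_relations_def defs)
    then have "?q \<odot> ((l \<ominus> \<one>) \<otimes> E 0) = \<zero>"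
      by (simp add: m_assoc alg_eval_eigenvector[OF _ _ kE])
    then have "inverse ?q \<odot> (?q \<odot> ((l \<ominus> \<one>) \<otimes> E 0)) = \<zero>" by simp
    then have "(l \<ominus> \<one>) \<otimes> E 0 = \<zero>" using q by simp
    moreover have "(l \<ominus> \<one>) \<otimes> E 0 = l \<otimes> E 0 \<ominus> E 0" by (simp add: minus_eq l_distr l_minus)
    ultimately show ?thesis by simp
  qed
  show "id_relations A d (g Mir_e) (g Mir_f) (g Mir_l) E"
    using eE fE lE lE0 commutator mirabolic E_outside E_sum E_mult
    unfolding id_relations_def by (simp flip: defs add: E_def)
qed

text \<open>
The converse, with the diagonal element whose \<open>j\<close>-th eigenvalue is the \<open>j\<close>-th weight in the role of
\<open>k\<close>. Since \<open>e\<close> and \<open>f\<close> shift the index by one, they change the weight by \<open>v\<^sup>2\<close> and \<open>v\<^sup>-\<^sup>2\<close>. All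
identities are checked on one idempotent at a time; \<open>P\<close> and \<open>Q\<close> enter only through their values at the weights.
\<close>

lemma id_imp_mir:
  fixes A (structure)
  assumes "kalgebra A"
    and cl [simp, intro]: "e \<in> carrier A" "f \<in> carrier A" "l \<in> carrier A" "\<And>j. E j \<in> carrier A"
    and rel: "id_relations A d e f l E"
    and g: "g Mir_e = e" "g Mir_f = f" "g Mir_l = l" "g Mir_k = diag A d E (weight d)"
      "g Mir_kinv = diag A d E (\<lambda>j. inverse (weight d j))"
  shows "mir_relations A g" and "cut_relations A d (g Mir_k) (g Mir_l)"
    and "r \<le> d \<Longrightarrow> alg_eval A (L_poly d r) (g Mir_k) = E (int r)"
proof -
  have rels: "\<And>r. r \<le> d \<Longrightarrow> e \<otimes> E (int r) = E (int r + 1) \<otimes> e"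
      "\<And>r. r \<le> d \<Longrightarrow> f \<otimes> E (int r) = E (int r - 1) \<otimes> f"
      "\<And>r. r \<le> d \<Longrightarrow> l \<otimes> E (int r) = E (int r) \<otimes> l"
    and ef: "e \<otimes> f \<ominus> f \<otimes> e = diag A d E (\<lambda>j. qint (2 * j - int d))"
    and l0: "l \<otimes> E 0 = E 0" and mirabolic: "mirabolic_relations A e f l"
    and out: "\<And>j. j < 0 \<or> int d < j \<Longrightarrow> E j = \<zero>"
    and orth: "\<And>r s. r \<le> d \<Longrightarrow> s \<le> d \<Longrightarrow>
      E (int r) \<otimes> E (int s) = (if r = s then E (int r) else \<zero>)"
    and sum: "finsum A (\<lambda>r. E (int r)) {0..d} = \<one>"
    using rel unfolding id_relations_def by blast+
  have nat: "\<exists>r\<le>d. j = int r" if "0 \<le> j" "j \<le> int d" for j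
    using that by (intro exI[of _ "nat j"]) auto
  interpret kalgebra A by fact
  interpret spectral_algebra A d E
  proof unfold_locales
    fix i j
    show "E i \<otimes> E j = (if i = j then E i else \<zero>)"
    proof (cases "(i < 0 \<or> int d < i) \<or> (j < 0 \<or> int d < j)")
      case True
      then show ?thesis using out[of i] out[of j] by auto
    next
      case False
      then show ?thesis using nat[of i] nat[of j] orth by fastforce
    qed
  qed (use out sum in auto)
  have eE: "e \<otimes> E j = E (j + 1) \<otimes> e" and fE: "f \<otimes> E j = E (j - 1) \<otimes> f"
    and lE: "l \<otimes> E j = E j \<otimes> l" if "0 \<le> j" "j \<le> int d" for j
    using rels nat[OF that] by auto
  let ?k = "diag A d E (weight d)" and ?k' = "diag A d E (\<lambda>j. inverse (weight d j))"
  \<comment> \<open>One computation covers \<open>e\<close> and \<open>f\<close>, which shift the index by \<open>t = 1\<close> and \<open>t = - 1\<close>.\<close>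
  have shift: "?k \<otimes> x \<otimes> ?k' = q \<odot> x"
    if x: "x \<in> carrier A" and xE: "\<And>j. 0 \<le> j \<Longrightarrow> j \<le> int d \<Longrightarrow> x \<otimes> E j = E (j + t) \<otimes> x"
      and q: "q = qv powi (2 * t)" for x t q
  proof (rule eqI_right)
    fix j assume j: "0 \<le> j" "j \<le> int d"
    have w: "weight d (j + t) = q * weight d j" using weight_shift[of "j + t" d t j] by (simp add: q)
    have "?k \<otimes> x \<otimes> ?k' \<otimes> E j = inverse (weight d j) \<odot> (?k \<otimes> (x \<otimes> E j))"
      using x by (simp add: m_assoc)
    also have "?k \<otimes> (x \<otimes> E j) = weight d (j + t) \<odot> (x \<otimes> E j)"
      using x unfolding xE[OF j] by (simp flip: m_assoc)
    also have "inverse (weight d j) \<odot> (weight d (j + t) \<odot> (x \<otimes> E j)) =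
        (inverse (weight d j) * weight d (j + t)) \<odot> (x \<otimes> E j)"
      using x by simp
    also have "inverse (weight d j) * weight d (j + t) = q"
      unfolding w by simp
    finally show "?k \<otimes> x \<otimes> ?k' \<otimes> E j = q \<odot> x \<otimes> E j"
      using x by simp
  qed (use x in auto)
  have "?k \<otimes> ?k' = \<one>" "?k' \<otimes> ?k = \<one>"
    by (rule eqI_right; simp add: m_assoc)+
  moreover have "?k \<otimes> e \<otimes> ?k' = qv ^ 2 \<odot> e"
    by (rule shift[of _ 1]) (auto simp: eE)
  moreover have "?k \<otimes> f \<otimes> ?k' = qv powi (-2) \<odot> f"
    by (rule shift[of _ "- 1"]) (auto simp: fE)
  moreover have "e \<otimes> f \<ominus> f \<otimes> e = (1 / (qv - inverse qv)) \<odot> (?k \<ominus> ?k')"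
    unfolding ef by (rule qint_diag[symmetric]) (rule spectral_algebra_axioms)
  moreover have "?k \<otimes> l = l \<otimes> ?k"
  proof (rule eqI_right)
    fix j assume j: "0 \<le> j" "j \<le> int d"
    have "?k \<otimes> l \<otimes> E j = ?k \<otimes> E j \<otimes> l" using lE[OF j] by (simp add: m_assoc del: diag_E)
    also have "\<dots> = l \<otimes> ?k \<otimes> E j" using lE[OF j] by (simp add: m_assoc)
    finally show "?k \<otimes> l \<otimes> E j = l \<otimes> ?k \<otimes> E j" .
  qed auto
  ultimately show "mir_relations A g"
    using mirabolic unfolding mir_relations_def Let_def g by blast
  have P: "alg_eval A (P_poly d) ?k = \<zero>"
  proof (rule eqI_right)
    fix j assume "0 \<le> j" "j \<le> int d"
    then obtain r where r: "r \<le> d" "j = int r" using nat by blast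
    then show "alg_eval A (P_poly d) ?k \<otimes> E j = \<zero> \<otimes> E j"
      using poly_P[of r d] by (simp add: alg_eval_diag qalpha_weight)
  qed auto
  have Q: "(l \<ominus> \<one>) \<otimes> alg_eval A (Q_poly d) ?k = \<zero>"
  proof (rule eqI_right)
    fix j assume "0 \<le> j" "j \<le> int d"
    then obtain r where r: "r \<le> d" "j = int r" using nat by blast
    have "(l \<ominus> \<one>) \<otimes> E 0 = \<zero>"
      using l0 by (simp add: minus_eq l_distr l_minus r_neg)
    then show "(l \<ominus> \<one>) \<otimes> alg_eval A (Q_poly d) ?k \<otimes> E j = \<zero> \<otimes> E j"
      using r poly_Q[of r d] by (cases "r = 0") (simp_all add: alg_eval_diag qalpha_weight m_assoc)
  qed auto
  show "cut_relations A d (g Mir_k) (g Mir_l)"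
    using P Q by (simp add: cut_relations_def g)
  show "alg_eval A (L_poly d r) (g Mir_k) = E (int r)" if r: "r \<le> d"
    unfolding g
  proof (rule eqI_right)
    fix j assume "0 \<le> j" "j \<le> int d"
    then obtain s where s: "s \<le> d" "j = int s" using nat by blast
    then show "alg_eval A (L_poly d r) ?k \<otimes> E j = E (int r) \<otimes> E j"
      using poly_L[OF r, of s] by (simp add: alg_eval_diag qalpha_weight)
  qed auto
qed

section \<open>Presentations\<close>

lemma id_rels_carrier: "id_rels d \<subseteq> carrier (free_alg (id_gens d))"
proof -
  have "(\<Sum>r = 0..n. p r) \<in> carrier (free_alg (id_gens d))"
    if "\<And>r. p r \<in> carrier (free_alg (id_gens d))"
    for n and p :: "nat \<Rightarrow> (id_gen, ratfun) fpoly"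
    using that by (induction n) (simp_all add: free_alg_closed)
  then show ?thesis
    unfolding id_rels_def Let_def
    by (auto simp: free_alg_closed power2_eq_square)
qed

lemma mir_rels_carrier: "mir_rels \<subseteq> carrier (free_alg UNIV)"
  by auto

lemma mir_ideal_kalgebra_ideal: "kalgebra_ideal (free_alg UNIV) mir_ideal"
proof -
  interpret kalgebra "free_alg UNIV :: (ratfun, (mir_gen, ratfun) fpoly) module"
    by (rule kalgebra_free_alg)
  show "kalgebra_ideal (free_alg UNIV) mir_ideal"
    unfolding mir_ideal_def
    by (intro kalgebra_ideal.intro kalgebra_axioms genideal_ideal) auto
qed

lemma kalgebra_U_mir: "kalgebra U_mir"
  unfolding U_mir_def by (rule kalgebra_ideal.kalgebra_quot_alg[OF mir_ideal_kalgebra_ideal])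

lemma mir_elt_closed [simp]: "mir_elt x \<in> carrier U_mir"
  unfolding U_mir_def mir_elt_def by (rule kalgebra_ideal.proj_closed[OF mir_ideal_kalgebra_ideal]) simp

lemma U2_ideal_kalgebra_ideal: "kalgebra_ideal U_mir (U2_ideal d)"
proof -
  interpret kalgebra U_mir by (rule kalgebra_U_mir)
  show "kalgebra_ideal U_mir (U2_ideal d)"
    unfolding U2_ideal_def
    by (intro kalgebra_ideal.intro kalgebra_axioms genideal_ideal) auto
qed

lemma kalgebra_U2: "kalgebra (U2 d)"
  unfolding U2_def by (rule kalgebra_ideal.kalgebra_quot_alg[OF U2_ideal_kalgebra_ideal])

lemma id_ideal_kalgebra_ideal: "kalgebra_ideal (free_alg (id_gens d)) (id_ideal d)"
proof -
  interpret kalgebra "free_alg (id_gens d) :: (ratfun, (id_gen, ratfun) fpoly) module"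
    by (rule kalgebra_free_alg)
  show "kalgebra_ideal (free_alg (id_gens d)) (id_ideal d)"
    unfolding id_ideal_def
    by (intro kalgebra_ideal.intro kalgebra_axioms genideal_ideal id_rels_carrier)
qed

lemma kalgebra_U_id: "kalgebra (U_id d)"
  unfolding U_id_def by (rule kalgebra_ideal.kalgebra_quot_alg[OF id_ideal_kalgebra_ideal])

text \<open>
\<open>U2 d\<close> is a quotient of a quotient; this is the composite of the two projections, through which
all questions about \<open>U2 d\<close> are pulled back to the free algebra.
\<close>

definition U2_proj :: "nat \<Rightarrow> (mir_gen, ratfun) fpoly \<Rightarrow> (mir_gen, ratfun) fpoly set set" where
  "U2_proj d = (\<lambda>x. U2_ideal d +>\<^bsub>U_mir\<^esub> x) \<circ> (\<lambda>p. mir_ideal +>\<^bsub>free_alg UNIV\<^esub> p)"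

lemma U2_proj_hom: "U2_proj d \<in> alg_hom (free_alg UNIV) (U2 d)"
  unfolding U2_proj_def
  by (rule alg_hom_compose[of _ _ U_mir])
    (simp_all only: U_mir_def U2_def kalgebra_ideal.proj_hom[OF mir_ideal_kalgebra_ideal]
      kalgebra_ideal.proj_hom[OF U2_ideal_kalgebra_ideal, unfolded U_mir_def])

lemma U2_proj_gen: "U2_proj d (gen x) = U2_elt d x"
  by (simp add: U2_proj_def U2_elt_def mir_elt_def)

lemma U2_elt_closed [simp]: "U2_elt d x \<in> carrier (U2 d)"
  unfolding U2_def U2_elt_def by (rule kalgebra_ideal.proj_closed[OF U2_ideal_kalgebra_ideal]) simp

lemma U2_carrierE:
  assumes "S \<in> carrier (U2 d)"
  obtains p where "S = U2_proj d p"
  using assms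
  by (auto simp: U2_def U2_proj_def U_mir_def
      elim!: kalgebra_ideal.quot_carrierE[OF U2_ideal_kalgebra_ideal, unfolded U_mir_def] kalgebra_ideal.quot_carrierE[OF mir_ideal_kalgebra_ideal])

lemma U2_hom_eqI:
  assumes "kalgebra B" "h \<in> alg_hom (U2 d) B" "h' \<in> alg_hom (U2 d) B"
    and "\<And>x. h (U2_elt d x) = h' (U2_elt d x)" and "S \<in> carrier (U2 d)"
  shows "h S = h' S"
proof -
  obtain p where p: "S = U2_proj d p" using assms(5) by (rule U2_carrierE)
  have "(h \<circ> U2_proj d) p = (h' \<circ> U2_proj d) p"
    by (rule free_alg_hom_unique[OF assms(1) alg_hom_compose[OF U2_proj_hom assms(2)]
          alg_hom_compose[OF U2_proj_hom assms(3)]])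
      (simp_all add: U2_proj_gen assms(4))
  then show ?thesis by (simp add: p)
qed

lemma U2_relations:
  "mir_relations (U2 d) (U2_elt d)" "cut_relations (U2 d) d (U2_elt d Mir_k) (U2_elt d Mir_l)"
proof -
  interpret M: kalgebra U_mir by (rule kalgebra_U_mir)
  interpret U: kalgebra "U2 d" by (rule kalgebra_U2)
  interpret p: kalgebra_hom U_mir "U2 d" "\<lambda>x. U2_ideal d +>\<^bsub>U_mir\<^esub> x"
    by unfold_locales (simp only: U2_def kalgebra_ideal.proj_hom[OF U2_ideal_kalgebra_ideal])
  have hom: "free_alg_hom UNIV (U2 d) (U2_proj d)"
    by unfold_locales (rule U2_proj_hom)
  have "U2_proj d r = \<zero>\<^bsub>U2 d\<^esub>" if "r \<in> mir_rels" for r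
  proof -
    interpret F: kalgebra "free_alg UNIV :: (ratfun, (mir_gen, ratfun) fpoly) module"
      by (rule kalgebra_free_alg)
    have "r \<in> mir_ideal" using that F.genideal_self[OF mir_rels_carrier] by (auto simp: mir_ideal_def)
    then have "mir_ideal +>\<^bsub>free_alg UNIV\<^esub> r = \<zero>\<^bsub>U_mir\<^esub>"
      unfolding U_mir_def by (subst kalgebra_ideal.proj_zero_iff[OF mir_ideal_kalgebra_ideal]) auto
    then show ?thesis by (simp add: U2_proj_def)
  qed
  then show "mir_relations (U2 d) (U2_elt d)"
    using mir_rels_vanish_iff[OF hom] by (simp add: U2_proj_gen)
  let ?R = "{alg_eval U_mir (P_poly d) (mir_elt Mir_k),
     (mir_elt Mir_l \<ominus>\<^bsub>U_mir\<^esub> \<one>\<^bsub>U_mir\<^esub>) \<otimes>\<^bsub>U_mir\<^esub> alg_eval U_mir (Q_poly d) (mir_elt Mir_k)}"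
  have R: "?R \<subseteq> carrier U_mir" by auto
  have "U2_ideal d +>\<^bsub>U_mir\<^esub> x = \<zero>\<^bsub>U2 d\<^esub>" if "x \<in> ?R" for x
  proof -
    have "x \<in> U2_ideal d" using that M.genideal_self[OF R] unfolding U2_ideal_def by blast
    moreover have "x \<in> carrier U_mir" using that R by blast
    ultimately show ?thesis unfolding U2_def by (simp add: kalgebra_ideal.proj_zero_iff[OF U2_ideal_kalgebra_ideal])
  qed
  from this[of "alg_eval U_mir (P_poly d) (mir_elt Mir_k)"]
    this[of "(mir_elt Mir_l \<ominus>\<^bsub>U_mir\<^esub> \<one>\<^bsub>U_mir\<^esub>) \<otimes>\<^bsub>U_mir\<^esub> alg_eval U_mir (Q_poly d) (mir_elt Mir_k)"]
  show "cut_relations (U2 d) d (U2_elt d Mir_k) (U2_elt d Mir_l)"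
    by (simp add: cut_relations_def U2_elt_def)
qed

text \<open>
The universal property of \<open>U2 d\<close>: a homomorphism on the free algebra is pushed down twice, first
through the mirabolic relators and then through the two relators of level \<open>d\<close>.
\<close>

lemma U2_universal:
  assumes "kalgebra B" and g: "\<And>x. g x \<in> carrier B"
    and mir: "mir_relations B g" and cut: "cut_relations B d (g Mir_k) (g Mir_l)"
  obtains h where "h \<in> alg_hom (U2 d) B" "\<And>x. h (U2_elt d x) = g x"
proof -
  interpret M: kalgebra U_mir by (rule kalgebra_U_mir)
  interpret B: kalgebra B by fact
  obtain h0 where h0: "h0 \<in> alg_hom (free_alg UNIV) B" "\<And>x. h0 (gen x) = g x"
    using free_alg_hom_exists[OF assms(1), of UNIV g] g by auto
  interpret h0: free_alg_hom UNIV B h0 by unfold_locales fact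
  have "\<forall>r\<in>mir_rels. h0 r = \<zero>\<^bsub>B\<^esub>"
    using mir mir_rels_vanish_iff[OF h0.free_alg_hom_axioms] by (simp add: h0(2))
  then have "h0 p = \<zero>\<^bsub>B\<^esub>" if "p \<in> mir_ideal" for p
    using h0.vanishes_on_genideal[OF mir_rels_carrier] that by (auto simp: mir_ideal_def)
  then obtain h1 where h1: "h1 \<in> alg_hom U_mir B" "\<And>p. h1 (mir_ideal +>\<^bsub>free_alg UNIV\<^esub> p) = h0 p"
    using kalgebra_ideal.quot_hom_exists[OF mir_ideal_kalgebra_ideal assms(1) h0(1)] by (auto simp: U_mir_def)
  have h1_elt: "h1 (mir_elt x) = g x" for x by (simp add: mir_elt_def h1(2) h0(2))
  interpret h1: kalgebra_hom U_mir B h1 by unfold_locales fact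
  have "h1 x = \<zero>\<^bsub>B\<^esub>" if "x \<in> U2_ideal d" for x
    using that unfolding U2_ideal_def
    by (rule h1.vanishes_on_genideal[rotated 2])
      (use cut in \<open>auto simp: h1_elt cut_relations_def\<close>)
  then obtain h2 where h2: "h2 \<in> alg_hom (U2 d) B"
    "\<And>x. x \<in> carrier U_mir \<Longrightarrow> h2 (U2_ideal d +>\<^bsub>U_mir\<^esub> x) = h1 x"
    using kalgebra_ideal.quot_hom_exists[OF U2_ideal_kalgebra_ideal assms(1) h1(1)] unfolding U2_def by blast
  show thesis
    by (rule that[OF h2(1)]) (simp add: U2_elt_def h2(2) h1_elt)
qed

lemma id_proj_hom:
  "(\<lambda>p. id_ideal d +>\<^bsub>free_alg (id_gens d)\<^esub> p) \<in> alg_hom (free_alg (id_gens d)) (U_id d)"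
  unfolding U_id_def by (rule kalgebra_ideal.proj_hom[OF id_ideal_kalgebra_ideal])

lemma id_elt_closed [simp]: "x \<in> id_gens d \<Longrightarrow> id_elt d x \<in> carrier (U_id d)"
  unfolding U_id_def id_elt_def by (rule kalgebra_ideal.proj_closed[OF id_ideal_kalgebra_ideal]) simp

lemma U_id_hom_eqI:
  assumes "kalgebra B" "h \<in> alg_hom (U_id d) B" "h' \<in> alg_hom (U_id d) B"
    and gens: "\<And>x. x \<in> id_gens d \<Longrightarrow> h (id_elt d x) = h' (id_elt d x)"
    and "S \<in> carrier (U_id d)"
  shows "h S = h' S"
proof -
  obtain p where p: "p \<in> carrier (free_alg (id_gens d))" "S = id_ideal d +>\<^bsub>free_alg (id_gens d)\<^esub> p"
    using assms(5) unfolding U_id_def by (rule kalgebra_ideal.quot_carrierE[OF id_ideal_kalgebra_ideal])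
  have "(h \<circ> (\<lambda>p. id_ideal d +>\<^bsub>free_alg (id_gens d)\<^esub> p)) p =
      (h' \<circ> (\<lambda>p. id_ideal d +>\<^bsub>free_alg (id_gens d)\<^esub> p)) p"
    by (rule free_alg_hom_unique[OF assms(1) alg_hom_compose[OF id_proj_hom assms(2)]
          alg_hom_compose[OF id_proj_hom assms(3)] _ p(1)])
      (use gens in \<open>simp add: id_elt_def\<close>)
  then show ?thesis by (simp add: p)
qed

text \<open>
The images of the idempotent generators, extended by zero to all integer indices.
\<close>

definition id_eps :: "nat \<Rightarrow> int \<Rightarrow> (id_gen, ratfun) fpoly set" where
  "id_eps d j = (if 0 \<le> j \<and> j \<le> int d then id_elt d (Id_eps (nat j)) else \<zero>\<^bsub>U_id d\<^esub>)"

lemma id_eps_closed [simp]: "id_eps d j \<in> carrier (U_id d)"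
proof -
  interpret kalgebra "U_id d" by (rule kalgebra_U_id)
  show ?thesis by (simp add: id_eps_def nat_le_iff)
qed

lemma U_id_relations:
  "id_relations (U_id d) d (id_elt d Id_e) (id_elt d Id_f) (id_elt d Id_l) (id_eps d)"
proof -
  let ?p = "\<lambda>p. id_ideal d +>\<^bsub>free_alg (id_gens d)\<^esub> p"
  interpret U: kalgebra "U_id d" by (rule kalgebra_U_id)
  interpret F: kalgebra "free_alg (id_gens d) :: (ratfun, (id_gen, ratfun) fpoly) module"
    by (rule kalgebra_free_alg)
  interpret p: free_alg_hom "id_gens d" "U_id d" ?p
    by unfold_locales (rule id_proj_hom)
  have "?p r = \<zero>\<^bsub>U_id d\<^esub>" if "r \<in> id_rels d" for r
  proof -
    have "r \<in> id_ideal d"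
      using that F.genideal_self[OF id_rels_carrier] by (auto simp: id_ideal_def)
    moreover have "r \<in> carrier (free_alg (id_gens d))" using that id_rels_carrier by blast
    ultimately show ?thesis unfolding U_id_def by (simp add: kalgebra_ideal.proj_zero_iff[OF id_ideal_kalgebra_ideal])
  qed
  moreover have "?p (eps_gen d j) = id_eps d j" for j
    using p.fpoly_hom_const(1) by (simp add: eps_gen_def id_eps_def id_elt_def)
  ultimately show ?thesis
    using id_rels_vanish_iff[OF p.free_alg_hom_axioms] by (simp add: id_elt_def)
qed

lemma U_id_universal:
  assumes "kalgebra B" and cl: "e \<in> carrier B" "f \<in> carrier B" "l \<in> carrier B" "\<And>j. E j \<in> carrier B"
    and rel: "id_relations B d e f l E"
  obtains h where "h \<in> alg_hom (U_id d) B" "h (id_elt d Id_e) = e" "h (id_elt d Id_f) = f"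
    "h (id_elt d Id_l) = l" "\<And>r. r \<le> d \<Longrightarrow> h (id_elt d (Id_eps r)) = E (int r)"
proof -
  interpret B: kalgebra B by fact
  define g where "g x = (case x of Id_e \<Rightarrow> e | Id_f \<Rightarrow> f | Id_l \<Rightarrow> l | Id_eps r \<Rightarrow> E (int r))" for x
  have "g x \<in> carrier B" for x using cl by (simp add: g_def split: id_gen.split)
  then obtain h0 where h0: "h0 \<in> alg_hom (free_alg (id_gens d)) B"
    "\<And>x. x \<in> id_gens d \<Longrightarrow> h0 (gen x) = g x"
    using free_alg_hom_exists[OF assms(1), of "id_gens d" g] by blast
  interpret h0: free_alg_hom "id_gens d" B h0 by unfold_locales fact
  have "E j = \<zero>\<^bsub>B\<^esub>" if "j < 0 \<or> int d < j" for j
    using rel that unfolding id_relations_def by blast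
  then have "h0 (eps_gen d j) = E j" for j
    by (simp add: eps_gen_def h0.fpoly_hom_const h0(2) g_def nat_le_iff not_le)
  then have "\<forall>r\<in>id_rels d. h0 r = \<zero>\<^bsub>B\<^esub>"
    using rel id_rels_vanish_iff[OF h0.free_alg_hom_axioms] by (simp add: h0(2) g_def)
  then have "h0 p = \<zero>\<^bsub>B\<^esub>" if "p \<in> id_ideal d" for p
    using h0.vanishes_on_genideal[OF id_rels_carrier] that by (auto simp: id_ideal_def)
  then obtain h where h: "h \<in> alg_hom (U_id d) B"
    "\<And>p. p \<in> carrier (free_alg (id_gens d)) \<Longrightarrow> h (id_ideal d +>\<^bsub>free_alg (id_gens d)\<^esub> p) = h0 p"
    using kalgebra_ideal.quot_hom_exists[OF id_ideal_kalgebra_ideal assms(1) h0(1)] unfolding U_id_def by blast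
  show thesis
    by (rule that[OF h(1)]) (simp_all add: id_elt_def h(2) h0(2) g_def)
qed

section \<open>The isomorphism\<close>

lemma alg_iso_if_inverse:
  assumes "kalgebra A" "kalgebra B" "h \<in> alg_hom A B" "h' \<in> alg_hom B A"
    and "\<And>x. x \<in> carrier A \<Longrightarrow> h' (h x) = x" "\<And>y. y \<in> carrier B \<Longrightarrow> h (h' y) = y"
  shows "h \<in> alg_iso A B"
proof -
  have "bij_betw h (carrier A) (carrier B)"
    using assms(3-6) by (intro bij_betwI[of _ _ _ h']) (auto simp: alg_hom_def ring_hom_closed)
  then show ?thesis using assms(3) by (simp add: alg_iso_def alg_hom_def ring_iso_def)
qed

lemma alg_iso_restrict:
  assumes "kalgebra A" "h \<in> alg_iso A B"
  shows "restrict h (carrier A) \<in> alg_iso A B"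
proof -
  interpret kalgebra A by fact
  have "bij_betw (restrict h (carrier A)) (carrier A) (carrier B)"
    using assms(2) bij_betw_cong[of "carrier A" "restrict h (carrier A)" h]
    by (simp add: alg_iso_def ring_iso_def)
  then show ?thesis
    using assms(2) by (auto simp: alg_iso_def ring_iso_def ring_hom_def)
qed

lemma alg_hom_id: "(\<lambda>x. x) \<in> alg_hom A A"
  by (simp add: alg_hom_def ring_hom_def)

text \<open>
The two computations with relations give homomorphisms in both directions by the universal
properties. They are inverse to each other, which has to be checked on generators only: the
idempotents return because the Lagrange idempotents of the diagonal element are the given ones,
and \<open>k\<close> with its inverse returns because both are diagonal in the
Lagrange idempotents of \<open>k\<close>.
\<close>

lemma U_id_iso_U2:
  obtains \<phi> where "\<phi> \<in> alg_iso (U_id d) (U2 d)" "\<phi> (id_elt d Id_e) = U2_elt d Mir_e"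
    "\<phi> (id_elt d Id_f) = U2_elt d Mir_f" "\<phi> (id_elt d Id_l) = U2_elt d Mir_l"
    "\<And>r. r \<le> d \<Longrightarrow> \<phi> (id_elt d (Id_eps r)) = U2_eps d r"
proof -
  interpret U: kalgebra "U_id d" by (rule kalgebra_U_id)
  interpret V: kalgebra "U2 d" by (rule kalgebra_U2)
  define E where "E = lagrange_idem (U2 d) d (U2_elt d Mir_k)"
  have E_closed: "E j \<in> carrier (U2 d)" for j
    by (simp add: E_def lagrange_idem_def)
  have E_eps: "E (int r) = U2_eps d r" if "r \<le> d" for r
    using that by (simp add: E_def lagrange_idem_def U2_eps_def)
  note V = mir_imp_id[where A = "U2 d" and d = d and g = "U2_elt d", OF kalgebra_U2 U2_elt_closed U2_relations, folded E_def]
  obtain \<phi> where \<phi>: "\<phi> \<in> alg_hom (U_id d) (U2 d)" "\<phi> (id_elt d Id_e) = U2_elt d Mir_e"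
    "\<phi> (id_elt d Id_f) = U2_elt d Mir_f" "\<phi> (id_elt d Id_l) = U2_elt d Mir_l"
    "\<And>r. r \<le> d \<Longrightarrow> \<phi> (id_elt d (Id_eps r)) = E (int r)"
    by (rule U_id_universal[OF kalgebra_U2 _ _ _ _ V(1)]) (simp_all add: E_closed)
  define g where "g x = (case x of Mir_e \<Rightarrow> id_elt d Id_e | Mir_f \<Rightarrow> id_elt d Id_f | Mir_l \<Rightarrow> id_elt d Id_l
    | Mir_k \<Rightarrow> diag (U_id d) d (id_eps d) (weight d)
    | Mir_kinv \<Rightarrow> diag (U_id d) d (id_eps d) (\<lambda>j. inverse (weight d j)))" for x
  have diag_closed: "diag (U_id d) d (id_eps d) c \<in> carrier (U_id d)" for c
    unfolding diag_def by (rule U.finsum_closed) auto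
  then have g_closed: "g x \<in> carrier (U_id d)" for x
    by (simp add: g_def split: mir_gen.split)
  have "mir_relations (U_id d) g" "cut_relations (U_id d) d (g Mir_k) (g Mir_l)"
    and L: "\<And>r. r \<le> d \<Longrightarrow> alg_eval (U_id d) (L_poly d r) (g Mir_k) = id_eps d (int r)"
    by (rule id_imp_mir[OF kalgebra_U_id _ _ _ _ U_id_relations]; simp add: g_def)+
  then obtain \<psi> where \<psi>: "\<psi> \<in> alg_hom (U2 d) (U_id d)" "\<And>x. \<psi> (U2_elt d x) = g x"
    using U2_universal[where g = g, OF kalgebra_U_id g_closed] by blast
  interpret \<phi>: kalgebra_hom "U_id d" "U2 d" \<phi> by unfold_locales (rule \<phi>(1))
  interpret \<psi>: kalgebra_hom "U2 d" "U_id d" \<psi> by unfold_locales (rule \<psi>(1))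
  have \<phi>_eps: "\<phi> (id_eps d (int r)) = E (int r)" if "r \<le> d" for r
    using that by (simp add: id_eps_def \<phi>(5))
  have \<phi>_diag: "\<phi> (diag (U_id d) d (id_eps d) c) = diag (U2 d) d E c" for c
  proof -
    have "\<phi> (diag (U_id d) d (id_eps d) c) =
        finsum (U2 d) (\<lambda>r. \<phi> (c (int r) \<odot>\<^bsub>U_id d\<^esub> id_eps d (int r))) {0..d}"
      unfolding diag_def by (rule \<phi>.hom_finsum) auto
    also have "\<dots> = diag (U2 d) d E c"
      unfolding diag_def
      by (rule V.finsum_cong') (simp_all add: E_closed \<phi>_eps)
    finally show ?thesis .
  qed
  have "\<psi> (\<phi> S) = S" if "S \<in> carrier (U_id d)" for S
  proof -
    have "(\<psi> \<circ> \<phi>) S = (\<lambda>x. x) S"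
    proof (rule U_id_hom_eqI[OF kalgebra_U_id alg_hom_compose[OF \<phi>(1) \<psi>(1)] alg_hom_id _ that])
      fix x assume "x \<in> id_gens d"
      then consider "x = Id_e" | "x = Id_f" | "x = Id_l" | r where "x = Id_eps r" "r \<le> d"
        by (auto simp: id_gens_def)
      then show "(\<psi> \<circ> \<phi>) (id_elt d x) = id_elt d x"
      proof cases
        case (4 r)
        then show ?thesis
          using L[of r] by (simp add: \<phi>(5) E_eps U2_eps_def \<psi>(2) id_eps_def)
      qed (simp_all add: \<phi> \<psi>(2) g_def)
    qed
    then show ?thesis by simp
  qed
  moreover have "\<phi> (\<psi> S) = S" if "S \<in> carrier (U2 d)" for S
  proof -
    have "(\<phi> \<circ> \<psi>) S = (\<lambda>x. x) S"
    proof (rule U2_hom_eqI[OF kalgebra_U2 alg_hom_compose[OF \<psi>(1) \<phi>(1)] alg_hom_id _ that])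
      fix x
      show "(\<phi> \<circ> \<psi>) (U2_elt d x) = U2_elt d x"
        by (cases x) (simp_all add: \<psi>(2) g_def \<phi>(2-4) \<phi>_diag flip: V(2,3))
    qed
    then show ?thesis by simp
  qed
  ultimately have "\<phi> \<in> alg_iso (U_id d) (U2 d)"
    by (intro alg_iso_if_inverse[OF kalgebra_U_id kalgebra_U2 \<phi>(1) \<psi>(1)])
  then show thesis by (rule that) (simp_all add: \<phi> E_eps)
qed

theorem theorem6p2:
  fixes d :: nat
  shows "\<exists>!\<phi>. \<phi> \<in> extensional (carrier (U_id d)) \<and> \<phi> \<in> alg_iso (U_id d) (U2 d) \<and>
    \<phi> (id_elt d Id_e) = U2_elt d Mir_e \<and>
    \<phi> (id_elt d Id_f) = U2_elt d Mir_f \<and>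
    \<phi> (id_elt d Id_l) = U2_elt d Mir_l \<and>
    (\<forall>r. 0 \<le> r \<and> r \<le> d \<longrightarrow> \<phi> (id_elt d (Id_eps r)) = U2_eps d r)"
    (is "\<exists>!\<phi>. ?T \<phi>")
proof -
  obtain \<phi> where \<phi>: "\<phi> \<in> alg_iso (U_id d) (U2 d)" "\<phi> (id_elt d Id_e) = U2_elt d Mir_e"
    "\<phi> (id_elt d Id_f) = U2_elt d Mir_f" "\<phi> (id_elt d Id_l) = U2_elt d Mir_l"
    "\<And>r. r \<le> d \<Longrightarrow> \<phi> (id_elt d (Id_eps r)) = U2_eps d r"
    by (rule U_id_iso_U2[of d]) blast
  let ?\<phi> = "restrict \<phi> (carrier (U_id d))"
  have ex: "?T ?\<phi>"
    using alg_iso_restrict[OF kalgebra_U_id \<phi>(1)] \<phi>(2-) by simp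
  show ?thesis
  proof (rule ex1I[where P = ?T, OF ex])
    fix \<chi> assume \<chi>: "?T \<chi>"
    show "\<chi> = ?\<phi>"
    proof (rule extensionalityI)
      fix S assume "S \<in> carrier (U_id d)"
      then show "\<chi> S = ?\<phi> S"
      proof (rule U_id_hom_eqI[OF kalgebra_U2, rotated 3])
        show "\<chi> \<in> alg_hom (U_id d) (U2 d)" "?\<phi> \<in> alg_hom (U_id d) (U2 d)"
          using \<chi> ex by (simp_all add: alg_iso_def alg_hom_def ring_iso_def)
        show "\<chi> (id_elt d x) = ?\<phi> (id_elt d x)" if "x \<in> id_gens d" for x
          using that \<chi> ex by (auto simp: id_gens_def)
      qed
    qed (use \<chi> in auto)
  qed
qed

end
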